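(* For all integers $N>K\ge 1$, the extended Markov kernel $\Lambda^N_K:\widetilde{\mathbb G}_N\dashrightarrow\widetilde{\mathbb G}_K$ is Feller; that is, the operator $f\mapsto \Lambda^N_K f$, $(\Lambda^N_K f)(X)=\sum_{Y\in\widetilde{\mathbb G}_K}\Lambda^N_K(X,Y)f(Y)$ for $X\in\widetilde{\mathbb G}_N$, maps $C_0(\widetilde{\mathbb G}_K)$ into $C_0(\widetilde{\mathbb G}_N)$.
   Context: Fix $q\in(0,1)$, $\zeta_+>0$, $\zeta_-<0$. Let $\mathfrak L=\{\zeta_+q^n:n\in\mathbb Z\}\cup\{\zeta_-q^n:n\in\mathbb Z\}\subset\mathbb R$ and $\bar{\mathfrak L}=\mathfrak L\cup\{0\}$. For $a<a'$ in $\mathfrak L$ set $I(a,a')=[a,a')\cap\mathfrak L$ if $a<a'<0$; $I(a,a')=[a,a']\cap\mathfrak L$ if $a<0<a'$; $I(a,a')=(a,a']\cap\mathfrak L$ if $0<a<a'$. For $M\ge1$, $\mathbb G_M$ is the set of $M$-point subsets $A=(a_1<\dots<a_M)$ of $\mathfrak L$. Write $|A|=|a_1|\cdots|a_M|$, $V(a_1,\dots,a_M)=\prod_{1\le i<j\le M}(a_i-a_j)$, and $|V(A)|$ for its absolute value. For $X=(x_1<\dots<x_{N+1})\in\mathbb G_{N+1}$ and $Y=(y_1<\dots<y_N)\in\mathbb G_N$ write $Y\prec X$ if $y_i\in I(x_i,x_{i+1})$ for $i=1,\dots,N$. Set $$\Lambda^{N+1}_N(X,Y)=(q;q)_N\,|Y|\,\frac{|V(Y)|}{|V(X)|}\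 \text{ if } Y\prec X,\qquad \Lambda^{N+1}_N(X,Y)=0\ \text{ otherwise},$$ where $(a;q)_N=\prod_{i=0}^{N-1}(1-aq^i)$. This is a stochastic matrix of format $\mathbb G_{N+1}\times\mathbb G_N$. For $N>K\ge1$ put $\Lambda^N_K=\Lambda^N_{N-1}\cdots\Lambda^{K+1}_K$, a stochastic matrix of format $\mathbb G_N\times\mathbb G_K$. Identify $\mathbb G_N$ with a subset of the cone $\Delta_N=\{(a_1,\dots,a_N)\in\mathbb R^N:a_1\le\dots\le a_N\}$; $\widetilde{\mathbb G}_N$ is the closure of $\mathbb G_N$ in $\Delta_N$ with the induced topology. Its elements are the $N$-point configurations on $\bar{\mathfrak L}$ in which only $0$ may be a multiple point; it is countable and locally compact. The map $X\mapsto\Lambda^N_K(X,\cdot)$ from $\mathbb G_N$ to probability measures on $\mathbb G_K$ extends uniquely to a map from $\widetilde{\mathbb G}_N$ to the set of probability measures on $\widetilde{\mathbb G}_K$ that is continuous for the weak topology (convergence on bounded continuous functions on $\widetilde{\mathbb G}_K$); the extension is again denoted $\Lambda^N_K$, with entries $\Lambda^N_K(X,Y)$, $X\in\widetilde{\mathbb G}_N$, $Y\in\widetilde{\mathbb G}_K$. For a locally compact space $\mathfrak X$, $C_0(\mathfrak X)$ denotes the Banach space of (real-valued) continuous functions on $\mathfrak X$ vanishing at infinity, with the supremum norm. *)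

theory Defs
  imports "HOL-Analysis.Analysis" "HOL-Probability.Probability"
begin

text \<open>
  A point \<open>(a\<^sub>1, \<dots>, a\<^sub>M)\<close> of \<open>\<real>\<^sup>M\<close> is a function \<open>a :: nat \<Rightarrow> real\<close> with \<open>a i = 0\<close> for \<open>i \<ge> M\<close>, indexed
  from \<open>0\<close>. The ambient topology is the product topology on \<open>nat \<Rightarrow> real\<close>, which induces the usual
  topology on this copy of \<open>\<real>\<^sup>M\<close> (cf. the library's \<open>Euclidean_space\<close>).
\<close>

definition cone :: "nat \<Rightarrow> (nat \<Rightarrow> real) set" where
  "cone M = {a. (\<forall>i j. i < j \<and> j < M \<longrightarrow> a i \<le> a j) \<and> (\<forall>i\<ge>M. a i = 0)}"

definition vandermonde :: "nat \<Rightarrow> (nat \<Rightarrow> real) \<Rightarrow> real" where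
  "vandermonde M a = (\<Prod>j<M. \<Prod>i<j. a i - a j)"

definition abs_prod :: "nat \<Rightarrow> (nat \<Rightarrow> real) \<Rightarrow> real" where
  "abs_prod M a = (\<Prod>i<M. \<bar>a i\<bar>)"

definition qpoch :: "real \<Rightarrow> real \<Rightarrow> nat \<Rightarrow> real" where
  "qpoch a q n = (\<Prod>i<n. 1 - a * q ^ i)"

context
  fixes q zp zm :: real  \<comment> \<open>\<open>q\<close>, \<open>\<zeta>\<^sub>+\<close> and \<open>\<zeta>\<^sub>-\<close>\<close>
begin

definition lattice_pts :: "real set" where
  "lattice_pts = range (\<lambda>n::int. zp * q powi n) \<union> range (\<lambda>n::int. zm * q powi n)"

text \<open>Only meaningful for \<open>a < a'\<close> in the lattice; in particular neither endpoint is \<open>0\<close>.\<close>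

definition lattice_interval :: "real \<Rightarrow> real \<Rightarrow> real set" where
  "lattice_interval a a' =
     (if a' < 0 then {a..<a'} else if a < 0 then {a..a'} else {a<..a'}) \<inter> lattice_pts"

text \<open>The set \<open>\<bbbG>\<^sub>M\<close>: an \<open>M\<close>-point subset of the lattice is identified with its increasing enumeration.\<close>

definition conf :: "nat \<Rightarrow> (nat \<Rightarrow> real) set" where
  "conf M = {a. (\<forall>i<M. a i \<in> lattice_pts) \<and> (\<forall>i j. i < j \<and> j < M \<longrightarrow> a i < a j) \<and>
                (\<forall>i\<ge>M. a i = 0)}"

text \<open>The set \<open>\<bbbG>\<^sub>M\<close> with a tilde: the closure of \<open>conf M\<close> relative to the cone.\<close>

definition conf_closure :: "nat \<Rightarrow> (nat \<Rightarrow> real) set" where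
  "conf_closure M = cone M \<inter> closure (conf M)"

definition interlaces :: "nat \<Rightarrow> (nat \<Rightarrow> real) \<Rightarrow> (nat \<Rightarrow> real) \<Rightarrow> bool" where
  "interlaces N Y X \<longleftrightarrow> X \<in> conf (Suc N) \<and> Y \<in> conf N \<and>
     (\<forall>i<N. Y i \<in> lattice_interval (X i) (X (Suc i)))"

definition link_step :: "nat \<Rightarrow> (nat \<Rightarrow> real) \<Rightarrow> (nat \<Rightarrow> real) \<Rightarrow> real" where
  "link_step N X Y =
     (if interlaces N Y X
      then qpoch q q N * abs_prod N Y * (\<bar>vandermonde N Y\<bar> / \<bar>vandermonde (Suc N) X\<bar>)
      else 0)"

text \<open>\<open>link_iter K d\<close> is the matrix product of the steps from level \<open>K + d\<close> down to level \<open>K\<close>.\<close>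

primrec link_iter :: "nat \<Rightarrow> nat \<Rightarrow> (nat \<Rightarrow> real) \<Rightarrow> (nat \<Rightarrow> real) \<Rightarrow> real" where
  "link_iter K 0 X Y = (if X = Y then 1 else 0)"
| "link_iter K (Suc d) X Y =
     (\<Sum>\<^sub>\<infinity>Z\<in>conf (K + d). link_step (K + d) X Z * link_iter K d Z Y)"

definition link :: "nat \<Rightarrow> nat \<Rightarrow> (nat \<Rightarrow> real) \<Rightarrow> (nat \<Rightarrow> real) \<Rightarrow> real" where
  "link N K = link_iter K (N - K)"

text \<open>
  Since \<open>conf_closure K\<close> is countable, its probability measures are exactly the \<open>pmf\<close>s whose support
  it contains. The last conjunct is continuity for the weak topology.
\<close>

definition is_link_extension ::
    "nat \<Rightarrow> nat \<Rightarrow> ((nat \<Rightarrow> real) \<Rightarrow> (nat \<Rightarrow> real) pmf) \<Rightarrow> bool" where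
  "is_link_extension N K E \<longleftrightarrow>
     (\<forall>X\<in>conf_closure N. set_pmf (E X) \<subseteq> conf_closure K) \<and>
     (\<forall>X\<in>conf N. \<forall>Y. pmf (E X) Y = link N K X Y) \<and>
     (\<forall>f :: (nat \<Rightarrow> real) \<Rightarrow> real.
        continuous_on (conf_closure K) f \<and> bounded (f ` conf_closure K) \<longrightarrow>
        continuous_on (conf_closure N) (\<lambda>X. measure_pmf.expectation (E X) f))"

text \<open>
  The extension is unique on \<open>conf_closure N\<close>, because \<open>conf N\<close> is dense there; the choice operator
  only fixes irrelevant values outside \<open>conf_closure N\<close>.
\<close>

definition ext_link :: "nat \<Rightarrow> nat \<Rightarrow> (nat \<Rightarrow> real) \<Rightarrow> (nat \<Rightarrow> real) pmf" where
  "ext_link N K = (SOME E. is_link_extension N K E)"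

definition ext_link_op ::
    "nat \<Rightarrow> nat \<Rightarrow> ((nat \<Rightarrow> real) \<Rightarrow> real) \<Rightarrow> (nat \<Rightarrow> real) \<Rightarrow> real" where
  "ext_link_op N K f X = (\<Sum>\<^sub>\<infinity>Y\<in>conf_closure K. pmf (ext_link N K X) Y * f Y)"

end

text \<open>\<open>C\<^sub>0(S)\<close> for a subspace \<open>S\<close>; only the values of the function on \<open>S\<close> matter.\<close>

definition C0 :: "'a::topological_space set \<Rightarrow> ('a \<Rightarrow> real) set" where
  "C0 S = {f. continuous_on S f \<and>
              (\<forall>e>0. \<exists>C. compact C \<and> C \<subseteq> S \<and> (\<forall>x\<in>S - C. \<bar>f x\<bar> < e))}"

end

theory Submission
  imports Defs "Jordan_Normal_Form.Determinant" "HOL-Probability.Product_PMF"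
begin

text \<open>
  Expanding the Vandermonde determinant turns the one-step average of a product
  \<open>\<Prod>\<^sub>i g(y\<^sub>i)\<close> into a determinant of increments of \<open>q\<close>-antiderivatives over consecutive points of
  \<open>X\<close>. For polynomial \<open>g\<close>, Newton interpolation at the points of \<open>X\<close> divides this determinant by the
  Vandermonde product of \<open>X\<close> and leaves a polynomial in \<open>X\<close>. So the one-step average of such functions
  extends continuously to the closure; by Stone--Weierstrass so does that of every continuous
  function, and the Riesz theorem on countable compact sets turns the limits into probability measures.

  For the Feller property, drop the point of \<open>X\<close> that escapes to infinity, together with the adjacent
  point of \<open>Y\<close>: what remains is the kernel one level lower, which has mass one, and the mass
  that stays in a fixed box decays like \<open>T\<^sup>-\<^sup>N\<close>. By density it suffices to see this for
  configurations without points at \<open>0\<close>. Both properties survive composition of kernels.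
\<close>

section \<open>Determinants by Newton interpolation\<close>

text \<open>The obstacle is the boundary: where several points of X merge at \<open>0\<close>, the
  Vandermonde product of X vanishes and the explicit kernel loses its meaning. Divided differences
  obtained by synthetic division never divide by a difference of nodes, so they survive the merging
  and depend continuously on the nodes. The constant (q; q)_N is dictated by g = 1: the
  q-antiderivative of y^i has leading coefficient 1/(1 - q^(i+1)), and the determinant becomes the
  product of these. Tightness is automatic, since interlacing keeps Y within the range of X: near a
  given X all measures live on one compact box. Countability of the box means that no diffuse part
  can appear, so a limit functional is a sum of point masses. The exponent N counts the differences
  between the escaping point of X and the other N points, all of order T or larger, whereas the
  corresponding differences in Y stay bounded on a fixed box. The estimate requires a point of Y to
  drop, hence a target level of at least 1.\<close>

primrec iterated_div :: "(nat \<Rightarrow> real) \<Rightarrow> nat \<Rightarrow> real poly \<Rightarrow> real poly" where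
  "iterated_div x 0 p = p"
| "iterated_div x (Suc k) p = synthetic_div (iterated_div x k p) (x k)"

text \<open>The divided difference p[x_0, ..., x_k], in a form that also makes sense for coincident
  nodes.\<close>

definition divdiff :: "(nat \<Rightarrow> real) \<Rightarrow> nat \<Rightarrow> real poly \<Rightarrow> real" where
  "divdiff x k p = poly (iterated_div x k p) (x k)"

definition newton_basis :: "(nat \<Rightarrow> real) \<Rightarrow> nat \<Rightarrow> real \<Rightarrow> real" where
  "newton_basis x k t = (\<Prod>m<k. t - x m)"

lemma newton_basis_node [simp]: "i < k \<Longrightarrow> newton_basis x k (x i) = 0"
  unfolding newton_basis_def by (rule prod_zero) auto

lemma newton_expansion_remainder:
  "poly p t = (\<Sum>k<n. newton_basis x k t * divdiff x k p)
     + newton_basis x n t * poly (iterated_div x n p) t"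
proof (induction n)
  case 0
  then show ?case by (simp add: newton_basis_def)
next
  case (Suc n)
  have "poly (iterated_div x n p) t
      = (t - x n) * poly (iterated_div x (Suc n) p) t + divdiff x n p"
    using arg_cong[OF synthetic_div_correct'[of "x n" "iterated_div x n p"], of "\<lambda>r. poly r t"]
    by (simp add: divdiff_def algebra_simps)
  with Suc show ?case by (simp add: newton_basis_def algebra_simps)
qed

lemma newton_expansion:
  assumes "i < n"
  shows "poly p (x i) = (\<Sum>k<n. newton_basis x k (x i) * divdiff x k p)"
  using newton_expansion_remainder[where t = "x i" and n = n and x = x] assms by simp

text \<open>Horner's recurrence, read from the top coefficient downwards. It serves both the leading
  coefficient and the continuity in the node.\<close>

lemma coeff_synthetic_div:
  fixes p :: "real poly"
  shows "coeff (synthetic_div p c) n = coeff p (Suc n) + c * coeff (synthetic_div p c) (Suc n)"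
  using arg_cong[OF synthetic_div_correct[of p c], of "\<lambda>r. coeff r (Suc n)"] by simp

lemma lead_coeff_synthetic_div:
  fixes p :: "real poly"
  assumes "degree p > 0"
  shows "lead_coeff (synthetic_div p c) = lead_coeff p"
proof -
  have "coeff (synthetic_div p c) (Suc (degree p - 1)) = 0"
    by (rule coeff_eq_0) (use assms in \<open>simp add: degree_synthetic_div\<close>)
  then show ?thesis
    using coeff_synthetic_div[of p c "degree p - 1"] assms
    by (simp add: degree_synthetic_div)
qed

text \<open>Each division by a monic linear factor lowers the degree by one and keeps the leading
  coefficient. Consequently the divided differences of the monomials form an upper triangular matrix
  with unit diagonal.\<close>

lemma iterated_div_monom:
  "k \<le> n \<Longrightarrow> degree (iterated_div x k (monom 1 n)) = n - k
     \<and> lead_coeff (iterated_div x k (monom 1 n)) = 1"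
proof (induction k)
  case (Suc k)
  then have deg: "degree (iterated_div x k (monom 1 n)) = n - k"
    and lead: "coeff (iterated_div x k (monom 1 n)) (n - k) = 1"
    by auto
  show ?case
    using lead_coeff_synthetic_div[of "iterated_div x k (monom 1 n)" "x k"] Suc.prems
    by (simp add: degree_synthetic_div deg lead)
qed (simp add: degree_monom_eq)

lemma divdiff_monom_same: "divdiff x n (monom 1 n) = 1"
proof -
  have "degree (iterated_div x n (monom 1 n)) = 0"
    "lead_coeff (iterated_div x n (monom 1 n)) = 1"
    using iterated_div_monom[of n n x] by auto
  then show ?thesis
    unfolding divdiff_def by (metis degree_0_id lead_coeff_pCons(2) pCons_one poly_1 degree_pCons_0
        coeff_pCons_0 degree_eq_zeroE)
qed

lemma divdiff_monom_above: "n < k \<Longrightarrow> divdiff x k (monom 1 n) = 0"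
proof -
  assume "n < k"
  then have "iterated_div x k (monom 1 n) = 0"
  proof (induction k)
    case (Suc k)
    show ?case
    proof (cases "k = n")
      case True
      then show ?thesis using iterated_div_monom[of n n x] by (simp add: synthetic_div_eq_0_iff)
    next
      case False
      then show ?thesis using Suc by simp
    qed
  qed simp
  then show ?thesis by (simp add: divdiff_def)
qed

lemma divdiff_smult: "divdiff x k (Polynomial.smult c p) = c * divdiff x k p"
proof -
  have sd: "synthetic_div (Polynomial.smult c r) a = Polynomial.smult c (synthetic_div r a)" for r :: "real poly" and a
    by (induction r) (auto simp: algebra_simps)
  have "iterated_div x k (Polynomial.smult c p) = Polynomial.smult c (iterated_div x k p)"
    by (induction k) (auto simp: sd)
  then show ?thesis by (simp add: divdiff_def)
qed

lemma det_triangular_factor: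
  fixes a b :: "nat \<Rightarrow> nat \<Rightarrow> real"
  assumes "\<And>i k. i < k \<Longrightarrow> k < n \<Longrightarrow> a i k = 0"
  shows "Determinant.det (Matrix.mat n n (\<lambda>(i, j). \<Sum>k<n. a i k * b k j))
       = (\<Prod>i<n. a i i) * Determinant.det (Matrix.mat n n (\<lambda>(i, j). b i j))"
proof -
  let ?A = "Matrix.mat n n (\<lambda>(i, j). a i j)" and ?B = "Matrix.mat n n (\<lambda>(i, j). b i j)"
  have "Matrix.mat n n (\<lambda>(i, j). \<Sum>k<n. a i k * b k j) = ?A * ?B"
    by (rule eq_matI) (auto simp: scalar_prod_def lessThan_atLeast0)
  then have "Determinant.det (Matrix.mat n n (\<lambda>(i, j). \<Sum>k<n. a i k * b k j))
      = Determinant.det ?A * Determinant.det ?B"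
    by (simp add: det_mult[of ?A n ?B])
  moreover have "Determinant.det ?A = (\<Prod>i<n. a i i)"
    by (subst det_lower_triangular[of n])
      (use assms in \<open>auto simp: prod_list_diag_prod lessThan_atLeast0\<close>)
  ultimately show ?thesis by simp
qed

lemma det_mat_upper_triangular:
  assumes "\<And>i j. j < i \<Longrightarrow> i < n \<Longrightarrow> b i j = 0"
  shows "Determinant.det (Matrix.mat n n (\<lambda>(i, j). b i j)) = (\<Prod>i<n. b i i :: real)"
  by (subst det_upper_triangular[of _ n])
    (use assms in \<open>auto simp: prod_list_diag_prod lessThan_atLeast0\<close>)

text \<open>Newton expansion of the monomials factors the matrix: values of the Newton basis at its
  own nodes are lower triangular, divided differences of monomials are upper triangular with unit
  diagonal.\<close>

lemma det_vandermonde: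
  "Determinant.det (Matrix.mat n n (\<lambda>(i, j). y i ^ j)) = (\<Prod>i<n. newton_basis y i (y i))"
proof -
  have "Matrix.mat n n (\<lambda>(i, j). y i ^ j)
      = Matrix.mat n n (\<lambda>(i, j). \<Sum>k<n. newton_basis y k (y i) * divdiff y k (monom 1 j))"
    by (rule eq_matI) (auto simp: newton_expansion[symmetric] poly_monom)
  then have "Determinant.det (Matrix.mat n n (\<lambda>(i, j). y i ^ j))
      = (\<Prod>i<n. newton_basis y i (y i))
        * Determinant.det (Matrix.mat n n (\<lambda>(i, j). divdiff y i (monom 1 j)))"
    by (simp add: det_triangular_factor)
  then show ?thesis
    by (simp add: det_mat_upper_triangular divdiff_monom_above divdiff_monom_same)
qed

text \<open>
  The increment matrix is a lower triangular matrix of Newton basis increments times a matrix of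
  divided differences.
\<close>

lemma det_increments:
  "Determinant.det (Matrix.mat n n (\<lambda>(i, j). poly (p j) (x (Suc i)) - poly (p j) (x i)))
     = (\<Prod>i<n. newton_basis x (Suc i) (x (Suc i)))
       * Determinant.det (Matrix.mat n n (\<lambda>(i, j). divdiff x (Suc i) (p j)))"
proof -
  have "poly (p j) (x (Suc i)) - poly (p j) (x i) = (\<Sum>k<n. (newton_basis x (Suc k) (x (Suc i))
      - newton_basis x (Suc k) (x i)) * divdiff x (Suc k) (p j))" if "i < n" for i j
  proof -
    have "poly (p j) (x (Suc i)) - poly (p j) (x i)
        = (\<Sum>k<Suc n. (newton_basis x k (x (Suc i)) - newton_basis x k (x i)) * divdiff x k (p j))"
      using that by (simp add: newton_expansion[where n = "Suc n"] sum_subtractf[symmetric]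
          left_diff_distrib del: sum.lessThan_Suc)
    \<comment> \<open>\<open>newton_basis x 0\<close> is constant, so its increment vanishes and the
      index can be shifted.\<close>
    also have "\<dots> = (\<Sum>k<n. (newton_basis x (Suc k) (x (Suc i))
      - newton_basis x (Suc k) (x i)) * divdiff x (Suc k) (p j))"
      by (subst sum.lessThan_Suc_shift) (simp add: newton_basis_def)
    finally show ?thesis .
  qed
  then have "Matrix.mat n n (\<lambda>(i, j). poly (p j) (x (Suc i)) - poly (p j) (x i))
      = Matrix.mat n n (\<lambda>(i, j). \<Sum>k<n. (newton_basis x (Suc k) (x (Suc i))
      - newton_basis x (Suc k) (x i)) * divdiff x (Suc k) (p j))"
    by (intro eq_matI) auto
  \<comment> \<open>For i < k both \<open>x i\<close> and \<open>x (Suc i)\<close> are nodes of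
    \<open>newton_basis x (Suc k)\<close>, whence triangularity; on the diagonal only
    \<open>x i\<close> is a node, so one value remains.\<close>
  then show ?thesis by (simp add: det_triangular_factor)
qed

text \<open>Downward induction on the coefficient index by Horner's recurrence. The uniform bound d
  provides the start, because the degree itself may jump as x varies.\<close>

lemma continuous_on_coeff_synthetic_div:
  fixes P :: "'a::topological_space \<Rightarrow> real poly"
  assumes "\<And>n. continuous_on S (\<lambda>x. coeff (P x) n)" "\<And>x. degree (P x) \<le> d" "continuous_on S c"
  shows "continuous_on S (\<lambda>x. coeff (synthetic_div (P x) (c x)) n)"
proof (cases "n \<ge> d")
  case True
  have "coeff (synthetic_div (P x) (c x)) n = 0" for x
  proof (cases "degree (P x) = 0")
    case True
    then show ?thesis by (simp add: synthetic_div_eq_0_iff[THEN iffD2])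
  next
    case False
    then show ?thesis using True assms(2)[of x] by (intro coeff_eq_0) (simp add: degree_synthetic_div)
  qed
  then show ?thesis by simp
next
  case False
  then have "n \<le> d" by simp
  then show ?thesis
  proof (induction rule: inc_induct)
    case base
    have "coeff (synthetic_div (P x) (c x)) d = 0" for x
    proof (cases "degree (P x) = 0")
      case True
      then show ?thesis by (simp add: synthetic_div_eq_0_iff[THEN iffD2])
    next
      case False
      then show ?thesis using assms(2)[of x] by (intro coeff_eq_0) (simp add: degree_synthetic_div)
    qed
    then show ?case by simp
  next
    case (step m)
    then show ?case
      by (subst coeff_synthetic_div) (intro continuous_intros assms)
  qed
qed

lemma continuous_on_coordinate: "continuous_on S (\<lambda>x :: 'i \<Rightarrow> 'a::topological_space. x i)"
  by (rule continuous_on_subset[OF continuous_on_product_coordinates]) simp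

text \<open>The nodes may coincide, as they do at limit configurations with a multiple point at
  \<open>0\<close>.\<close>

lemma continuous_on_divdiff: "continuous_on S (\<lambda>x. divdiff x k p)"
proof -
  have c: "continuous_on S (\<lambda>x. coeff (iterated_div x k p) n)" for n
  proof (induction k arbitrary: n)
    case (Suc k)
    have deg: "degree (iterated_div x k p) \<le> degree p" for x
      by (induction k) (auto simp: degree_synthetic_div)
    show ?case
      using continuous_on_coeff_synthetic_div[OF Suc deg continuous_on_coordinate] by simp
  qed simp
  have deg: "degree (iterated_div x k p) \<le> degree p" for x
    by (induction k) (auto simp: degree_synthetic_div)
  have "divdiff x k p = (\<Sum>i\<le>degree p. coeff (iterated_div x k p) i * x k ^ i)" for x
    unfolding divdiff_def poly_altdef
    by (rule sum.mono_neutral_left) (use deg in \<open>auto simp: coeff_eq_0\<close>)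
  then show ?thesis
    by (auto intro!: continuous_intros c continuous_on_coordinate)
qed

section \<open>Sums over the lattice\<close>

lemma has_sum_product:
  fixes f :: "'a \<Rightarrow> real" and g :: "'b \<Rightarrow> real"
  assumes f: "(f has_sum s) A" and g: "(g has_sum t) B"
  shows "((\<lambda>(x, y). f x * g y) has_sum s * t) (A \<times> B)"
proof (rule has_sum_SigmaI)
  show "((\<lambda>y. case (x, y) of (x, y) \<Rightarrow> f x * g y) has_sum f x * t) B" for x
    using has_sum_cmult_right[OF g] by simp
  show "((\<lambda>x. f x * t) has_sum s * t) A"
    by (rule has_sum_cmult_left[OF f])
  have fa: "(\<lambda>x. \<bar>f x\<bar>) summable_on A" and ga: "(\<lambda>x. \<bar>g x\<bar>) summable_on B"
    using f g summable_on_iff_abs_summable_on_real[of f A] summable_on_iff_abs_summable_on_real[of g B]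
    by (auto simp: summable_on_def)
  have "(\<lambda>p. norm (case p of (x, y) \<Rightarrow> f x * g y)) summable_on A \<times> B"
    by (subst Infinite_Sum.abs_summable_on_Sigma_iff)
      (auto simp: abs_mult infsum_cmult_right' intro!: summable_on_cmult_right summable_on_cmult_left fa ga)
  then show "(\<lambda>(x, y). f x * g y) summable_on A \<times> B"
    by (rule Infinite_Sum.abs_summable_summable)
qed

text \<open>One coordinate at a time is split off as a Cartesian factor. \<open>PiE_dflt\<close>
  with default \<open>0\<close> is the shape of configurations, which are padded by \<open>0\<close>
  beyond their length.\<close>

lemma has_sum_prod_PiE_dflt:
  fixes f :: "'a \<Rightarrow> 'b \<Rightarrow> real"
  assumes "finite A" "\<And>i. i \<in> A \<Longrightarrow> (f i has_sum s i) (B i)"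
  shows "((\<lambda>g. \<Prod>i\<in>A. f i (g i)) has_sum (\<Prod>i\<in>A. s i)) (PiE_dflt A d B)"
  using assms
proof (induction A rule: finite_induct)
  case empty
  have "PiE_dflt {} d B = {\<lambda>_. d}" by (auto simp: PiE_dflt_def)
  then show ?case by (auto intro: has_sum_finiteI)
next
  case (insert a A)
  have upd: "(\<Prod>i\<in>A. f i ((g(a := y)) i)) = (\<Prod>i\<in>A. f i (g i))" for g y
    by (rule prod.cong) (use insert.hyps in auto)
  have "((\<lambda>(y, g). f a y * (\<Prod>i\<in>A. f i (g i))) has_sum s a * (\<Prod>i\<in>A. s i)) (B a \<times> PiE_dflt A d B)"
    by (rule has_sum_product) (use insert in auto)
  also have "?this \<longleftrightarrow> ((\<lambda>g. \<Prod>i\<in>insert a A. f i (g i)) has_sum s a * (\<Prod>i\<in>A. s i))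
      (PiE_dflt (insert a A) d B)"
    by (rule has_sum_reindex_bij_witness[of _ "\<lambda>g. (g a, g(a := d))" "\<lambda>(y, g). g(a := y)"])
      (use insert.hyps in \<open>auto simp: PiE_dflt_def upd[unfolded fun_upd_apply]\<close>)
  finally show ?case using insert.hyps by simp
qed

lemma has_sum_finite_sum:
  fixes f :: "'i \<Rightarrow> 'a \<Rightarrow> real"
  assumes "\<And>i. i \<in> I \<Longrightarrow> (f i has_sum s i) A"
  shows "((\<lambda>x. \<Sum>i\<in>I. f i x) has_sum (\<Sum>i\<in>I. s i)) A"
  using assms by (induction I rule: infinite_finite_induct) (auto intro: has_sum_add)

text \<open>The polynomial F with F(x) - F(q x) = x p(x) and F(0) = 0, that is, the Jackson integral
  of p from 0 to x divided by 1 - q.\<close>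

definition q_primitive :: "real \<Rightarrow> real poly \<Rightarrow> real poly" where
  "q_primitive q p = (\<Sum>i\<le>degree p. monom (coeff p i / (1 - q ^ Suc i)) (Suc i))"

lemma poly_q_primitive_0 [simp]: "poly (q_primitive q p) 0 = 0"
  by (simp add: q_primitive_def poly_sum poly_monom)

lemma poly_q_primitive_diff:
  assumes "0 < q" "q < 1"
  shows "poly (q_primitive q p) x - poly (q_primitive q p) (x * q) = x * poly p x"
proof -
  have *: "q ^ Suc i < 1" for i
    using assms by (metis power_Suc_less_one)
  have "c / (1 - q ^ Suc i) * x ^ Suc i - c / (1 - q ^ Suc i) * (x * q) ^ Suc i = c * x ^ Suc i" for c i
    using *[of i] by (simp add: power_mult_distrib divide_simps) (simp add: algebra_simps)
  then have "poly (q_primitive q p) x - poly (q_primitive q p) (x * q)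
      = (\<Sum>i\<le>degree p. coeff p i * x ^ Suc i)"
    by (simp add: q_primitive_def poly_sum poly_monom sum_subtractf[symmetric] del: power_Suc)
  then show ?thesis
    by (simp add: poly_altdef[of p] sum_distrib_left mult.assoc mult.left_commute)
qed

lemma q_primitive_monom:
  "q_primitive q (monom 1 n) = Polynomial.smult (1 / (1 - q ^ Suc n)) (monom 1 (Suc n))"
proof -
  have "q_primitive q (monom 1 n)
      = (\<Sum>i\<le>n. if i = n then monom (1 / (1 - q ^ Suc i)) (Suc i) else 0)"
    unfolding q_primitive_def by (rule sum.cong) (auto simp: degree_monom_eq)
  then show ?thesis by (simp add: Polynomial.smult_monom)
qed

section \<open>The lattice as geometric progressions\<close>

locale q_lattice =
  fixes q zp zm :: real
  assumes q_pos: "0 < q" and q_less_1: "q < 1" and zp_pos: "zp > 0" and zm_neg: "zm < 0"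
begin

abbreviation "L \<equiv> lattice_pts q zp zm"
abbreviation "G \<equiv> conf q zp zm"
abbreviation "Gbar \<equiv> conf_closure q zp zm"

lemma zero_notin_lattice: "0 \<notin> L"
  unfolding lattice_pts_def using q_pos zp_pos zm_neg by (auto simp: power_int_eq_0_iff)

lemma powi_le_iff: "q powi m \<le> q powi n \<longleftrightarrow> n \<le> m"
proof -
  have "q powi m < q powi n" if "n < m" for n m
    using power_int_strict_decreasing[OF that q_pos q_less_1] .
  then show ?thesis by (metis linorder_not_le order_le_less)
qed

text \<open>For a lattice point a, this is the part of the lattice from a (included) towards
  \<open>0\<close>. Lattice intervals are differences or unions of two rays.\<close>

definition ray :: "real \<Rightarrow> real set" where
  "ray a = range (\<lambda>n::nat. a * q ^ n)"

lemma lattice_scaled_range: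
  assumes "z \<noteq> 0" "a = z * q powi k"
  shows "{y \<in> range (\<lambda>n::int. z * q powi n). \<bar>y\<bar> \<le> \<bar>a\<bar>} = ray a"
proof -
  have eq: "a * q ^ n = z * q powi (k + int n)" for n
    using assms q_pos by (simp add: power_int_add)
  show ?thesis
  proof (intro equalityI subsetI)
    fix y assume "y \<in> {y \<in> range (\<lambda>n::int. z * q powi n). \<bar>y\<bar> \<le> \<bar>a\<bar>}"
    then obtain n where n: "y = z * q powi n" "\<bar>y\<bar> \<le> \<bar>a\<bar>" by auto
    then have "q powi n \<le> q powi k"
      using assms q_pos by (auto simp: abs_mult)
    then have "k \<le> n" by (simp add: powi_le_iff)
    then have "y = a * q ^ nat (n - k)" using n(1) eq[of "nat (n - k)"] by simp
    then show "y \<in> ray a" by (auto simp: ray_def)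
  next
    fix y assume "y \<in> ray a"
    then obtain n where n: "y = a * q ^ n" by (auto simp: ray_def)
    then have "y = z * q powi (k + int n)" by (simp only: eq)
    moreover have "\<bar>y\<bar> \<le> \<bar>a\<bar>"
      using n q_pos q_less_1 by (simp add: abs_mult mult_left_le power_le_one)
    ultimately show "y \<in> {y \<in> range (\<lambda>n::int. z * q powi n). \<bar>y\<bar> \<le> \<bar>a\<bar>}" by blast
  qed
qed

lemma ray_pos: "a \<in> L \<Longrightarrow> 0 < a \<Longrightarrow> {0<..a} \<inter> L = ray a"
proof -
  assume a: "a \<in> L" "0 < a"
  have neg: "zm * q powi n < 0" and pos: "zp * q powi n > 0" for n
    using zm_neg zp_pos q_pos by (simp_all add: mult_neg_pos)
  then obtain k where k: "a = zp * q powi k"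
    using a unfolding lattice_pts_def by (auto simp: not_less_iff_gr_or_eq) (metis less_asym)
  have "{0<..a} \<inter> L = {y \<in> range (\<lambda>n::int. zp * q powi n). \<bar>y\<bar> \<le> \<bar>a\<bar>}"
    using neg pos a(2) unfolding lattice_pts_def by (auto simp: order_less_imp_le) (meson less_asym)
  then show ?thesis using lattice_scaled_range[OF _ k] zp_pos by simp
qed

lemma ray_neg: "a \<in> L \<Longrightarrow> a < 0 \<Longrightarrow> {a..<0} \<inter> L = ray a"
proof -
  assume a: "a \<in> L" "a < 0"
  have neg: "zm * q powi n < 0" and pos: "zp * q powi n > 0" for n
    using zm_neg zp_pos q_pos by (simp_all add: mult_neg_pos)
  then obtain k where k: "a = zm * q powi k"
    using a unfolding lattice_pts_def by (auto simp: not_less_iff_gr_or_eq) (metis less_asym)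
  have "{a..<0} \<inter> L = {y \<in> range (\<lambda>n::int. zm * q powi n). \<bar>y\<bar> \<le> \<bar>a\<bar>}"
    using neg pos a(2) unfolding lattice_pts_def by (auto simp: order_less_imp_le abs_of_neg) (meson less_asym)
  then show ?thesis using lattice_scaled_range[OF _ k] zm_neg by simp
qed

text \<open>By the q-difference equation the sum telescopes along the ray from F(a) to F(0) = 0. The
  sign comes from |y| = sgn(a) y.\<close>

lemma has_sum_ray:
  assumes "a \<noteq> 0"
  shows "((\<lambda>y. \<bar>y\<bar> * poly p y) has_sum sgn a * poly (q_primitive q p) a) (ray a)"
proof -
  let ?P = "poly (q_primitive q p)"
  obtain C where C: "\<And>y. y \<in> {-\<bar>a\<bar>..\<bar>a\<bar>} \<Longrightarrow> \<bar>poly p y\<bar> \<le> C"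
  proof -
    have "bounded (poly p ` {-\<bar>a\<bar>..\<bar>a\<bar>})"
      by (intro compact_imp_bounded compact_continuous_image continuous_intros) auto
    then obtain B where "\<forall>y\<in>{-\<bar>a\<bar>..\<bar>a\<bar>}. \<bar>poly p y\<bar> \<le> B"
      by (auto simp: bounded_iff)
    then show ?thesis using that[of B] by blast
  qed
  have mem: "a * q ^ n \<in> {-\<bar>a\<bar>..\<bar>a\<bar>}" for n
  proof -
    have "\<bar>a * q ^ n\<bar> \<le> \<bar>a\<bar>"
      using q_pos q_less_1 by (simp add: abs_mult mult_left_le power_le_one)
    then show ?thesis by auto
  qed
  have inj: "inj (\<lambda>n::nat. a * q ^ n)"
    using assms q_pos q_less_1 by (auto simp: inj_on_def power_inject_exp')
  have increment: "\<bar>a * q ^ n\<bar> * poly p (a * q ^ n) = sgn a * (?P (a * q ^ n) - ?P (a * q ^ Suc n))" for n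
  proof -
    have "\<bar>a * q ^ n\<bar> = sgn a * (a * q ^ n)"
      using q_pos by (auto simp: abs_mult sgn_if)
    then show ?thesis
      using poly_q_primitive_diff[OF q_pos q_less_1, of p "a * q ^ n"] by (simp add: algebra_simps)
  qed
  have lim: "(\<lambda>n. a * q ^ n) \<longlonglongrightarrow> 0"
    using q_pos q_less_1 by (intro tendsto_mult_right_zero LIMSEQ_power_zero) auto
  have "(\<lambda>n. ?P (a * q ^ n)) \<longlonglongrightarrow> ?P 0"
    by (rule isCont_tendsto_compose[OF _ lim]) simp
  then have "(\<lambda>n. ?P (a * q ^ n) - ?P (a * q ^ Suc n)) sums (?P a - ?P 0)"
    using telescope_sums'[of "\<lambda>n. ?P (a * q ^ n)" "?P 0"] by simp
  then have sums: "(\<lambda>n. \<bar>a * q ^ n\<bar> * poly p (a * q ^ n)) sums (sgn a * ?P a)"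
    unfolding increment by (auto intro: sums_mult)
  \<comment> \<open>The unordered sum requires absolute convergence: p is bounded by C between -|a|
    and |a|, and the weights |y| decay geometrically.\<close>
  have "summable (\<lambda>n. norm (\<bar>a * q ^ n\<bar> * poly p (a * q ^ n)))"
  proof (rule summable_comparison_test)
    show "\<exists>N. \<forall>n\<ge>N. norm (norm (\<bar>a * q ^ n\<bar> * poly p (a * q ^ n))) \<le> \<bar>a\<bar> * C * q ^ n"
      using mult_left_mono[OF C[OF mem], of "\<bar>a\<bar> * q ^ n" for n] q_pos
      by (auto simp: abs_mult ac_simps)
    show "summable (\<lambda>n. \<bar>a\<bar> * C * q ^ n)"
      using q_pos q_less_1 by (intro summable_mult summable_geometric) auto
  qed
  from norm_summable_imp_has_sum[OF this sums]
  show ?thesis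
    unfolding ray_def by (subst has_sum_reindex[OF inj]) (simp add: o_def)
qed

text \<open>The half-open conventions make the interval a difference of nested rays, or a disjoint
  union when \<open>0\<close> lies inside; the signs of the two rays then combine to the same
  increment in every case.\<close>

lemma has_sum_lattice_interval:
  assumes "a \<in> L" "a' \<in> L" "a < a'"
  shows "((\<lambda>y. \<bar>y\<bar> * poly p y) has_sum poly (q_primitive q p) a' - poly (q_primitive q p) a)
    (lattice_interval q zp zm a a')"
proof -
  have nz: "a \<noteq> 0" "a' \<noteq> 0" using assms zero_notin_lattice by auto
  note sums = has_sum_ray[OF nz(1), of p] has_sum_ray[OF nz(2), of p]
  consider "a' < 0" | "a < 0" "0 < a'" | "0 < a" using assms(3) nz by linarith
  then show ?thesis
  proof cases
    case 1
    have "lattice_interval q zp zm a a' = ray a - ray a'"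
      using 1 assms ray_neg[symmetric] unfolding lattice_interval_def by auto
    moreover have "ray a' \<subseteq> ray a"
      using 1 assms ray_neg[symmetric] by auto
    ultimately show ?thesis
      using has_sum_Diff[OF sums(1) sums(2)] 1 assms by (simp add: sgn_if)
  next
    case 2
    have "lattice_interval q zp zm a a' = ray a \<union> ray a'"
      using 2 assms zero_notin_lattice ray_neg[symmetric] ray_pos[symmetric]
      unfolding lattice_interval_def by (auto simp: not_less_iff_gr_or_eq)
    moreover have "ray a \<inter> ray a' = {}"
      using 2 assms ray_neg[symmetric] ray_pos[symmetric] by auto
    ultimately show ?thesis
      using has_sum_Un_disjoint[OF sums(1) sums(2)] 2 by (simp add: sgn_if)
  next
    case 3
    have "lattice_interval q zp zm a a' = ray a' - ray a"
      using 3 assms ray_pos[symmetric] unfolding lattice_interval_def by auto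
    moreover have "ray a \<subseteq> ray a'"
      using 3 assms ray_pos[symmetric] by auto
    ultimately show ?thesis
      using has_sum_Diff[OF sums(2) sums(1)] 3 assms by (simp add: sgn_if)
  qed
qed

end

section \<open>The one-step kernel on lattice configurations\<close>

lemma abs_vandermonde:
  assumes "\<And>i j. i < j \<Longrightarrow> j < n \<Longrightarrow> a i \<le> a j"
  shows "\<bar>vandermonde n a\<bar> = (\<Prod>j<n. newton_basis a j (a j))"
proof -
  have "\<bar>a i - a j\<bar> = a j - a i" if "i < j" "j < n" for i j
    using assms[OF that] by simp
  then show ?thesis
    unfolding vandermonde_def newton_basis_def abs_prod by (intro prod.cong refl) auto
qed

text \<open>A bridge: expectations of a \<open>pmf\<close> are available through
  \<open>infsetsum\<close>, the lattice sums through \<open>has_sum\<close>.\<close>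

lemma has_sum_imp_infsetsum:
  fixes f :: "'a \<Rightarrow> real"
  assumes "(f has_sum s) A"
  shows "Infinite_Set_Sum.abs_summable_on f A" "infsetsum f A = s"
proof -
  have "(\<lambda>x. norm (f x)) summable_on A"
    using has_sum_imp_summable[OF assms] summable_on_iff_abs_summable_on_real[of f A] by blast
  then show abs: "Infinite_Set_Sum.abs_summable_on f A"
    using abs_summable_equivalent[of f A] by blast
  show "infsetsum f A = s"
    using infsetsum_infsum[OF abs] infsumI[OF assms] by simp
qed

lemma expectation_eq_has_sum:
  fixes f :: "'a \<Rightarrow> real"
  assumes "((\<lambda>x. pmf p x * f x) has_sum s) A" "set_pmf p \<subseteq> A"
  shows "measure_pmf.expectation p f = s"
proof -
  have "((\<lambda>x. pmf p x * f x) has_sum s) UNIV"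
    by (rule has_sum_cong_neutral[THEN iffD1, OF _ _ _ assms(1)])
      (use assms(2) in \<open>auto simp: pmf_eq_0_set_pmf\<close>)
  then show ?thesis
    unfolding pmf_expectation_eq_infsetsum
    by (rule has_sum_imp_infsetsum)
qed

lemma has_sum_expectation:
  fixes f :: "'a \<Rightarrow> real"
  assumes "\<And>x. x \<in> A \<Longrightarrow> \<bar>f x\<bar> \<le> B" "set_pmf p \<subseteq> A"
  shows "((\<lambda>x. pmf p x * f x) has_sum measure_pmf.expectation p f) A"
proof -
  have "(\<lambda>x. norm (pmf p x * f x)) summable_on A"
  proof (rule summable_on_comparison_test)
    show "(\<lambda>x. pmf p x * B) summable_on A"
      using pmf_abs_summable[of p A] abs_summable_equivalent[of "pmf p" A]
      by (intro summable_on_cmult_left) (simp add: Infinite_Sum.abs_summable_summable)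
    show "norm (pmf p x * f x) \<le> pmf p x * B" if "x \<in> A" for x
      using assms(1)[OF that] by (simp add: abs_mult mult_left_mono)
  qed simp
  then have "((\<lambda>x. pmf p x * f x) has_sum infsum (\<lambda>x. pmf p x * f x) A) A"
    by (rule has_sum_infsum[OF Infinite_Sum.abs_summable_summable])
  with expectation_eq_has_sum[OF this assms(2)] show ?thesis by simp
qed

lemma ex_pmf_of_has_sum:
  assumes "(f has_sum 1) A" "\<And>x. x \<in> A \<Longrightarrow> f x \<ge> 0" "\<And>x. x \<notin> A \<Longrightarrow> f x = 0"
  shows "\<exists>p. pmf p = f"
proof -
  have f: "(f has_sum 1) UNIV"
    by (rule has_sum_cong_neutral[THEN iffD1, OF _ _ _ assms(1)]) (use assms(3) in auto)
  have nonneg: "f x \<ge> 0" for x using assms(2,3)[of x] by (cases "x \<in> A") auto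
  have "(\<integral>\<^sup>+x. f x \<partial>count_space UNIV) = 1"
    using nn_integral_conv_infsetsum[OF has_sum_imp_infsetsum(1)[OF f] nonneg]
    by (simp add: has_sum_imp_infsetsum(2)[OF f])
  then have "pmf (embed_pmf f) = f" by (intro ext pmf_embed_pmf nonneg)
  then show ?thesis by blast
qed

context q_lattice
begin

section \<open>Interlacing configurations as a product set\<close>

lemma confD:
  assumes "X \<in> G N"
  shows "i < N \<Longrightarrow> X i \<in> L" "i < j \<Longrightarrow> j < N \<Longrightarrow> X i < X j" "N \<le> i \<Longrightarrow> X i = 0"
  using assms unfolding conf_def by auto

lemma conf_mono: "X \<in> G N \<Longrightarrow> i \<le> j \<Longrightarrow> j < N \<Longrightarrow> X i \<le> X j"
  using confD(2)[of X N i j] by (cases "i = j") auto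

lemma lattice_interval_bounds:
  "y \<in> lattice_interval q zp zm a a' \<Longrightarrow> a \<le> y \<and> y \<le> a' \<and> y \<in> L"
  unfolding lattice_interval_def by (auto split: if_splits)

text \<open>For b > 0 the right interval excludes b, for b < 0 the left one does; this makes the
  inequality strict.\<close>

lemma lattice_interval_disjoint:
  assumes "y \<in> lattice_interval q zp zm a b" "y' \<in> lattice_interval q zp zm b c" "b < c" "b \<in> L"
  shows "y < y'"
proof -
  have "b \<noteq> 0" using assms(4) zero_notin_lattice by auto
  then show ?thesis
    using assms(1-3) unfolding lattice_interval_def by (auto split: if_splits)
qed

text \<open>Points chosen independently, one per interval, are automatically in strictly increasing
  order. Sums over interlacing Y therefore factor over the coordinates.\<close>

lemma interlaces_eq_PiE_dflt:
  assumes X: "X \<in> G (Suc N)"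
  shows "{Y. interlaces q zp zm N Y X}
    = PiE_dflt {..<N} 0 (\<lambda>i. lattice_interval q zp zm (X i) (X (Suc i)))" (is "?A = ?B")
proof (intro equalityI subsetI)
  fix Y assume "Y \<in> ?A"
  then show "Y \<in> ?B"
    unfolding interlaces_def PiE_dflt_def using confD(3)[of Y N] by (auto simp: not_less)
next
  fix Y assume "Y \<in> ?B"
  then have Y: "\<And>i. i < N \<Longrightarrow> Y i \<in> lattice_interval q zp zm (X i) (X (Suc i))"
    "\<And>i. N \<le> i \<Longrightarrow> Y i = 0"
    by (auto simp: PiE_dflt_def)
  have step: "Y i < Y j" if "i < j" "j < N" for i j
  proof -
    have "Y i \<le> X (Suc i)" using Y(1)[of i] that lattice_interval_bounds by auto
    show ?thesis
    \<comment> \<open>Only neighbouring intervals share an endpoint; the others are separated by a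
      strict inequality in X.\<close>
    proof (cases "j = Suc i")
      case True
      then show ?thesis
        using lattice_interval_disjoint[OF Y(1)[of i], of "Y j" "X (Suc j)"] that Y(1)[of j]
          confD(1,2)[OF X] by auto
    next
      case False
      then have "X (Suc i) < X j" using that confD(2)[OF X, of "Suc i" j] by simp
      moreover have "X j \<le> Y j" using Y(1)[of j] that lattice_interval_bounds by auto
      ultimately show ?thesis using \<open>Y i \<le> X (Suc i)\<close> by simp
    qed
  qed
  have "Y \<in> G N"
    unfolding conf_def using step Y(2) lattice_interval_bounds[OF Y(1)] by blast
  then show "Y \<in> ?A" using X Y by (simp add: interlaces_def)
qed

text \<open>Up to the constant \<open>(q; q)\<^sub>N\<close> this is the one-step average of \<open>\<Prod>\<^sub>i p(y\<^sub>i)\<close>.\<close>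

definition power_det :: "nat \<Rightarrow> real poly \<Rightarrow> (nat \<Rightarrow> real) \<Rightarrow> real" where
  "power_det N p X = Determinant.det (Matrix.mat N N
     (\<lambda>(i, j). divdiff X (Suc i) (q_primitive q (p * monom 1 j))))"

text \<open>The Vandermonde product couples the coordinates, but each term of its Leibniz expansion
  is a product over them, with an extra weight \<open>Y i ^ \<sigma> i\<close> at coordinate i. The
  sums over single intervals reassemble, with the same signs, into a determinant.\<close>

lemma has_sum_interlacing:
  assumes X: "X \<in> G (Suc N)"
  shows "((\<lambda>Y. abs_prod N Y * \<bar>vandermonde N Y\<bar> * (\<Prod>i<N. poly p (Y i)))
    has_sum \<bar>vandermonde (Suc N) X\<bar> * power_det N p X) {Y. interlaces q zp zm N Y X}"
proof -
  let ?Q = "\<lambda>j. q_primitive q (p * monom 1 j)"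
  let ?P = "{\<sigma>. \<sigma> permutes {0..<N}}"
  let ?I = "\<lambda>i. lattice_interval q zp zm (X i) (X (Suc i))"
  have lt: "X i < X (Suc i)" if "i < N" for i using confD(2)[OF X, of i "Suc i"] that by simp
  have "((\<lambda>Y. \<Prod>i<N. \<bar>Y i\<bar> * poly (p * monom 1 (\<sigma> i)) (Y i))
      has_sum (\<Prod>i<N. poly (?Q (\<sigma> i)) (X (Suc i)) - poly (?Q (\<sigma> i)) (X i)))
      (PiE_dflt {..<N} 0 ?I)" for \<sigma>
  proof (rule has_sum_prod_PiE_dflt)
    show "((\<lambda>y. \<bar>y\<bar> * poly (p * monom 1 (\<sigma> i)) y) has_sum
        poly (?Q (\<sigma> i)) (X (Suc i)) - poly (?Q (\<sigma> i)) (X i)) (?I i)" if "i \<in> {..<N}" for i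
      using that by (intro has_sum_lattice_interval lt confD(1)[OF X]) auto
  qed simp
  then have "((\<lambda>Y. \<Sum>\<sigma>\<in>?P. signof \<sigma> * (\<Prod>i<N. \<bar>Y i\<bar> * poly (p * monom 1 (\<sigma> i)) (Y i)))
      has_sum (\<Sum>\<sigma>\<in>?P. signof \<sigma> * (\<Prod>i<N. poly (?Q (\<sigma> i)) (X (Suc i)) - poly (?Q (\<sigma> i)) (X i))))
      (PiE_dflt {..<N} 0 ?I)"
    by (intro has_sum_finite_sum has_sum_cmult_right)
  also have "(\<Sum>\<sigma>\<in>?P. signof \<sigma> * (\<Prod>i<N. poly (?Q (\<sigma> i)) (X (Suc i)) - poly (?Q (\<sigma> i)) (X i)))
      = Determinant.det (Matrix.mat N N (\<lambda>(i, j). poly (?Q j) (X (Suc i)) - poly (?Q j) (X i)))"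
    by (subst det_def'[of _ N]) (auto intro!: sum.cong prod.cong simp: lessThan_atLeast0)
  \<comment> \<open>Of the Suc N Newton factors of X the one with index 0 is an empty product; the
    others are exactly the prefactor in \<open>det_increments\<close>.\<close>
  also have "\<dots> = \<bar>vandermonde (Suc N) X\<bar> * power_det N p X"
  proof -
    have "\<bar>vandermonde (Suc N) X\<bar> = (\<Prod>i<Suc N. newton_basis X i (X i))"
      by (rule abs_vandermonde) (use conf_mono[OF X] in simp)
    also have "\<dots> = (\<Prod>i<N. newton_basis X (Suc i) (X (Suc i)))"
      unfolding prod.lessThan_Suc_shift by (simp add: newton_basis_def del: prod.lessThan_Suc)
    finally show ?thesis
      unfolding power_det_def using det_increments[of N ?Q X] by (simp only:)
  qed
  finally have sum: "((\<lambda>Y. \<Sum>\<sigma>\<in>?P. signof \<sigma> * (\<Prod>i<N. \<bar>Y i\<bar> * poly (p * monom 1 (\<sigma> i)) (Y i)))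
      has_sum \<bar>vandermonde (Suc N) X\<bar> * power_det N p X) {Y. interlaces q zp zm N Y X}"
    by (simp add: interlaces_eq_PiE_dflt[OF X])
  have "abs_prod N Y * \<bar>vandermonde N Y\<bar> * (\<Prod>i<N. poly p (Y i))
      = (\<Sum>\<sigma>\<in>?P. signof \<sigma> * (\<Prod>i<N. \<bar>Y i\<bar> * poly (p * monom 1 (\<sigma> i)) (Y i)))"
    if "interlaces q zp zm N Y X" for Y
  proof -
    have Y: "Y \<in> G N" using that by (simp add: interlaces_def)
    have "\<bar>vandermonde N Y\<bar> = Determinant.det (Matrix.mat N N (\<lambda>(i, j). Y i ^ j))"
      by (subst abs_vandermonde) (use conf_mono[OF Y] in \<open>auto simp: det_vandermonde\<close>)
    also have "\<dots> = (\<Sum>\<sigma>\<in>?P. signof \<sigma> * (\<Prod>i<N. Y i ^ \<sigma> i))"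
      by (subst det_def'[of _ N]) (auto intro!: sum.cong prod.cong simp: lessThan_atLeast0)
    finally show ?thesis
      by (simp only: sum_distrib_left sum_distrib_right)
        (auto intro!: sum.cong simp: abs_prod_def prod.distrib poly_monom)
  qed
  then show ?thesis
    by (intro has_sum_cong[THEN iffD1, OF _ sum]) auto
qed

lemma vandermonde_pos: "X \<in> G N \<Longrightarrow> \<bar>vandermonde N X\<bar> > 0"
proof -
  assume X: "X \<in> G N"
  have "X i - X j \<noteq> 0" if "i < j" "j < N" for i j using confD(2)[OF X that] by simp
  then show ?thesis unfolding vandermonde_def by auto
qed

lemma has_sum_link_step:
  assumes X: "X \<in> G (Suc N)"
  shows "((\<lambda>Y. link_step q zp zm N X Y * (\<Prod>i<N. poly p (Y i)))
    has_sum qpoch q q N * power_det N p X) (G N)"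
proof -
  let ?c = "qpoch q q N / \<bar>vandermonde (Suc N) X\<bar>"
  have "?c * (\<bar>vandermonde (Suc N) X\<bar> * power_det N p X) = qpoch q q N * power_det N p X"
    using vandermonde_pos[OF X] by simp
  then have sum: "((\<lambda>Y. ?c * (abs_prod N Y * \<bar>vandermonde N Y\<bar> * (\<Prod>i<N. poly p (Y i))))
      has_sum qpoch q q N * power_det N p X) {Y. interlaces q zp zm N Y X}"
    using has_sum_cmult_right[OF has_sum_interlacing[OF X, of p], of ?c] by simp
  show ?thesis
  proof (rule has_sum_cong_neutral[THEN iffD1, OF _ _ _ sum])
    fix Y assume "Y \<in> {Y. interlaces q zp zm N Y X} - G N"
    then show "?c * (abs_prod N Y * \<bar>vandermonde N Y\<bar> * (\<Prod>i<N. poly p (Y i))) = 0"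
      by (auto simp: interlaces_def)
  qed (simp_all add: link_step_def)
qed

lemma qpoch_q_pos: "qpoch q q N > 0"
  unfolding qpoch_def
proof (intro prod_pos ballI)
  fix i
  show "0 < 1 - q * q ^ i"
    using q_pos q_less_1 power_Suc_less_one[of q i] by simp
qed

text \<open>The matrix of divided differences is upper triangular with diagonal entries 1/(1 -
  q^(i+1)). Since the left side is the total mass of a kernel row, this proves
  stochasticity.\<close>

lemma power_det_1: "qpoch q q N * power_det N 1 X = 1"
proof -
  have ne: "q * q ^ i \<noteq> 1" for i
    using q_pos q_less_1 power_Suc_less_one[of q i] by simp
  have "power_det N 1 X = (\<Prod>i<N. divdiff X (Suc i) (q_primitive q (1 * monom 1 i)))"
    unfolding power_det_def
    by (rule det_mat_upper_triangular)
      (auto simp: q_primitive_monom divdiff_smult divdiff_monom_above)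
  also have "\<dots> = (\<Prod>i<N. 1 / (1 - q * q ^ i))"
    by (simp add: q_primitive_monom divdiff_smult divdiff_monom_same)
  finally show ?thesis
    by (simp add: qpoch_def prod.distrib[symmetric] ne del: prod_dividef)
qed

lemma continuous_on_power_det: "continuous_on S (power_det N p)"
proof -
  have "power_det N p X = (\<Sum>\<sigma>\<in>{\<sigma>. \<sigma> permutes {0..<N}}. signof \<sigma> *
      (\<Prod>i<N. divdiff X (Suc i) (q_primitive q (p * monom 1 (\<sigma> i)))))" for X
    unfolding power_det_def
    by (subst det_def'[of _ N]) (auto intro!: sum.cong prod.cong simp: lessThan_atLeast0)
  then have "power_det N p = (\<lambda>X. \<Sum>\<sigma>\<in>{\<sigma>. \<sigma> permutes {0..<N}}. signof \<sigma> *
      (\<Prod>i<N. divdiff X (Suc i) (q_primitive q (p * monom 1 (\<sigma> i)))))"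
    by blast
  then show ?thesis
    by (simp only:) (intro continuous_on_sum continuous_on_mult continuous_on_const
        continuous_on_prod continuous_on_divdiff)
qed

lemma link_step_nonneg: "link_step q zp zm N X Y \<ge> 0"
proof -
  have "abs_prod N Y \<ge> 0" unfolding abs_prod_def by (simp add: prod_nonneg)
  then show ?thesis
    unfolding link_step_def using less_imp_le[OF qpoch_q_pos[of N]]
    by (simp add: mult_nonneg_nonneg divide_nonneg_nonneg del: mult_eq_0_iff zero_le_mult_iff)
qed

definition link_pmf :: "nat \<Rightarrow> (nat \<Rightarrow> real) \<Rightarrow> (nat \<Rightarrow> real) pmf" where
  "link_pmf N X = (SOME p. pmf p = link_step q zp zm N X)"

lemma pmf_link_pmf:
  assumes "X \<in> G (Suc N)"
  shows "pmf (link_pmf N X) = link_step q zp zm N X"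
proof -
  have "(link_step q zp zm N X has_sum 1) (G N)"
    using has_sum_link_step[OF assms, of 1] by (simp add: power_det_1)
  then have "\<exists>p. pmf p = link_step q zp zm N X"
    by (rule ex_pmf_of_has_sum[OF _ link_step_nonneg]) (auto simp: link_step_def interlaces_def)
  then show ?thesis unfolding link_pmf_def by (rule someI_ex)
qed

lemma set_link_pmf:
  assumes "X \<in> G (Suc N)"
  shows "set_pmf (link_pmf N X) \<subseteq> {Y. interlaces q zp zm N Y X}"
  using pmf_link_pmf[OF assms] by (auto simp: set_pmf_iff link_step_def split: if_splits)

lemma expectation_link_pmf:
  assumes "X \<in> G (Suc N)"
  shows "measure_pmf.expectation (link_pmf N X) (\<lambda>Y. \<Prod>i<N. poly p (Y i))
    = qpoch q q N * power_det N p X"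
proof (rule expectation_eq_has_sum)
  show "((\<lambda>Y. pmf (link_pmf N X) Y * (\<Prod>i<N. poly p (Y i)))
      has_sum qpoch q q N * power_det N p X) (G N)"
    unfolding pmf_link_pmf[OF assms] by (rule has_sum_link_step[OF assms])
  show "set_pmf (link_pmf N X) \<subseteq> G N"
    using set_link_pmf[OF assms] unfolding interlaces_def by blast
qed

end

section \<open>Weak limits on countable compact sets\<close>

lemma integrable_pmf_bounded_on:
  fixes f :: "'a \<Rightarrow> real"
  assumes "\<And>x. x \<in> A \<Longrightarrow> \<bar>f x\<bar> \<le> B" "set_pmf p \<subseteq> A"
  shows "integrable (measure_pmf p) f"
  by (rule measure_pmf.integrable_const_bound[where B = B])
    (use assms in \<open>auto simp: AE_measure_pmf_iff\<close>)

lemma abs_expectation_diff_le: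
  fixes f g :: "'a \<Rightarrow> real"
  assumes "integrable (measure_pmf p) f" "integrable (measure_pmf p) g"
    "\<And>x. x \<in> set_pmf p \<Longrightarrow> \<bar>f x - g x\<bar> \<le> e"
  shows "\<bar>measure_pmf.expectation p f - measure_pmf.expectation p g\<bar> \<le> e"
proof -
  have "\<bar>measure_pmf.expectation p f - measure_pmf.expectation p g\<bar>
      = \<bar>measure_pmf.expectation p (\<lambda>x. f x - g x)\<bar>"
    using assms by simp
  also have "\<dots> \<le> measure_pmf.expectation p (\<lambda>x. \<bar>f x - g x\<bar>)"
    by (rule integral_abs_bound)
  also have "\<dots> \<le> measure_pmf.expectation p (\<lambda>_. e)"
    by (rule integral_mono_AE) (use assms in \<open>auto simp: AE_measure_pmf_iff\<close>)
  finally show ?thesis by simp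
qed

lemma compact_continuous_bound:
  fixes f :: "'a::topological_space \<Rightarrow> real"
  assumes "compact S" "continuous_on S f"
  obtains B where "B > 0" "\<And>x. x \<in> S \<Longrightarrow> \<bar>f x\<bar> \<le> B"
  using compact_imp_bounded[OF compact_continuous_image[OF assms(2,1)]]
  by (auto simp: bounded_pos)

text \<open>Tent functions whose radius is at most half the least distance between points of F, so
  that at most one of them is nonzero at any x.\<close>

lemma separating_bumps:
  fixes F :: "'a::metric_space set"
  assumes "finite F"
  obtains b :: "'a \<Rightarrow> 'a \<Rightarrow> real" where
    "\<And>y. continuous_on UNIV (b y)" "\<And>y x. b y x \<ge> 0" "\<And>y. b y y = 1"
    "\<And>x. (\<Sum>y\<in>F. b y x) \<le> 1"
proof -
  have "\<exists>d>0. \<forall>x\<in>F. x \<noteq> y \<longrightarrow> d \<le> dist y x" for y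
    using finite_set_avoid[OF assms, of y] by blast
  then obtain d where d: "\<And>y. d y > 0" "\<And>y x. x \<in> F \<Longrightarrow> x \<noteq> y \<Longrightarrow> d y \<le> dist y x"
    by metis
  \<comment> \<open>The element 1 keeps the minimum meaningful for empty F.\<close>
  define r where "r = Min (insert 1 (d ` F)) / 2"
  have r: "r > 0" "\<And>y. y \<in> F \<Longrightarrow> 2 * r \<le> d y"
    unfolding r_def using assms d(1) by auto
  define b where "b y x = max 0 (1 - dist x y / r)" for y x :: 'a
  show ?thesis
  proof
    show "continuous_on UNIV (b y)" for y
      unfolding b_def using r(1) by (intro continuous_intros) auto
    show "(\<Sum>y\<in>F. b y x) \<le> 1" for x
    proof (cases "\<exists>y\<in>F. b y x > 0")
      case True
      then obtain y where y: "y \<in> F" "b y x > 0" by blast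
      have "b z x = 0" if "z \<in> F - {y}" for z
      proof (rule ccontr)
        assume "b z x \<noteq> 0"
        then have "dist x z < r" "dist x y < r"
          using r(1) y(2) by (auto simp: b_def max_def divide_simps split: if_splits)
        then have "dist y z < 2 * r"
          using dist_triangle[of y z x] by (simp add: dist_commute)
        then show False using d(2)[of z y] r(2)[OF y(1)] that by auto
      qed
      then have "(\<Sum>y\<in>F. b y x) = b y x"
        using sum.remove[OF assms y(1), of "\<lambda>y. b y x"] by simp
      then show ?thesis using r(1) by (simp add: b_def)
    next
      case False
      then have "(\<Sum>y\<in>F. b y x) \<le> 0" by (intro sum_nonpos) (auto simp: not_less)
      then show ?thesis by simp
    qed
  qed (use r in \<open>auto simp: b_def\<close>)
qed

text \<open>A state on the continuous functions on S. In \<open>ex_weak_limit_pmf\<close> it is the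
  limit of expectations, to be represented by point masses.\<close>

locale positive_functional =
  fixes S :: "'a::metric_space set" and I :: "('a \<Rightarrow> real) \<Rightarrow> real"
  assumes compact: "compact S"
    and add: "continuous_on S f \<Longrightarrow> continuous_on S g \<Longrightarrow> I (\<lambda>x. f x + g x) = I f + I g"
    and scale: "continuous_on S f \<Longrightarrow> I (\<lambda>x. c * f x) = c * I f"
    and mono: "continuous_on S f \<Longrightarrow> continuous_on S g \<Longrightarrow> (\<And>x. x \<in> S \<Longrightarrow> f x \<le> g x) \<Longrightarrow> I f \<le> I g"
    and one: "I (\<lambda>_. 1) = 1"
begin

lemma zero: "I (\<lambda>_. 0) = 0"
  using scale[of "\<lambda>_. 1" 0] by simp

lemma nonneg: "continuous_on S f \<Longrightarrow> (\<And>x. x \<in> S \<Longrightarrow> 0 \<le> f x) \<Longrightarrow> 0 \<le> I f"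
  using mono[of "\<lambda>_. 0" f] by (simp add: zero)

lemma finite_sum:
  "finite F \<Longrightarrow> (\<And>y. y \<in> F \<Longrightarrow> continuous_on S (f y)) \<Longrightarrow> I (\<lambda>x. \<Sum>y\<in>F. f y x) = (\<Sum>y\<in>F. I (f y))"
  by (induction F rule: finite_induct) (auto simp: zero add continuous_on_sum)

definition admissible :: "'a \<Rightarrow> ('a \<Rightarrow> real) set" where
  "admissible y = {f. continuous_on S f \<and> (\<forall>x\<in>S. f x \<ge> 0) \<and> f y \<ge> 1}"

text \<open>By outer regularity, this is the only possible mass of a point under the representing measure.\<close>

definition mass :: "'a \<Rightarrow> real" where
  "mass y = (INF f\<in>admissible y. I f)"

lemma bdd_below_admissible: "bdd_below (I ` admissible y)"
  by (rule bdd_belowI[of _ 0]) (auto simp: admissible_def intro!: nonneg)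

lemma one_admissible: "(\<lambda>_. 1) \<in> admissible y"
  by (simp add: admissible_def)

lemma mass_le: "f \<in> admissible y \<Longrightarrow> mass y \<le> I f"
  unfolding mass_def by (rule cINF_lower[OF bdd_below_admissible])

lemma mass_nonneg: "mass y \<ge> 0"
  unfolding mass_def
proof (rule cINF_greatest)
  show "admissible y \<noteq> {}" using one_admissible by blast
qed (auto simp: admissible_def intro!: nonneg)

lemma mass_approx:
  assumes "e > 0"
  obtains f where "f \<in> admissible y" "I f < mass y + e"
proof -
  have "(INF f\<in>admissible y. I f) < mass y + e"
    using assms by (simp add: mass_def)
  then show ?thesis
    using that cINF_less_iff[OF _ bdd_below_admissible, of y] one_admissible by auto
qed

text \<open>Bumps cut out of f a piece around each y in F. The piece divided by f(y) is admissible
  at y, and together the pieces stay below f.\<close>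

lemma sum_mass_le:
  assumes F: "finite F" "F \<subseteq> S" and f: "continuous_on S f" "\<And>x. x \<in> S \<Longrightarrow> 0 \<le> f x"
  shows "(\<Sum>y\<in>F. mass y * f y) \<le> I f"
proof -
  obtain b :: "'a \<Rightarrow> 'a \<Rightarrow> real" where b:
    "\<And>y. continuous_on UNIV (b y)" "\<And>y x. b y x \<ge> 0" "\<And>y. b y y = 1"
    "\<And>x. (\<Sum>y\<in>F. b y x) \<le> 1"
    using separating_bumps[OF F(1)] by blast
  have c: "continuous_on S (\<lambda>x. b y x * f x)" for y
    using continuous_on_subset[OF b(1)] f(1) by (intro continuous_intros) auto
  have "mass y * f y \<le> I (\<lambda>x. b y x * f x)" if "y \<in> S" for y
  proof (cases "f y = 0")
    case True
    then show ?thesis using nonneg[OF c] b(2) f(2) by simp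
  next
    case False
    then have pos: "f y > 0" using f(2)[OF that] by simp
    then have "(\<lambda>x. (1 / f y) * (b y x * f x)) \<in> admissible y"
      unfolding admissible_def mem_Collect_eq
      using continuous_on_mult[OF continuous_on_const c, of "1 / f y" y] b(2)[of y] b(3)[of y] f(2)
      by simp
    then have "mass y \<le> (1 / f y) * I (\<lambda>x. b y x * f x)"
      unfolding scale[OF c[of y], of "1 / f y", symmetric] by (rule mass_le)
    then show ?thesis using pos by (simp add: field_simps)
  qed
  then have "(\<Sum>y\<in>F. mass y * f y) \<le> (\<Sum>y\<in>F. I (\<lambda>x. b y x * f x))"
    using F(2) by (intro sum_mono) auto
  also have "\<dots> = I (\<lambda>x. \<Sum>y\<in>F. b y x * f x)"
    by (rule finite_sum[symmetric]) (use F c in auto)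
  also have "\<dots> \<le> I f"
  proof (rule mono)
    show "(\<Sum>y\<in>F. b y x * f x) \<le> f x" if "x \<in> S" for x
      using mult_right_mono[OF b(4)[of x] f(2)[OF that]] by (simp add: sum_distrib_right)
  qed (use c f in \<open>auto intro!: continuous_on_sum\<close>)
  finally show ?thesis .
qed

lemma mass_summable: "mass summable_on S" "infsum mass S \<le> 1"
proof -
  have le: "sum mass F \<le> 1" if "finite F" "F \<subseteq> S" for F
    using sum_mass_le[OF that, of "\<lambda>_. 1"] by (simp add: one)
  then show "mass summable_on S"
    by (intro nonneg_bdd_above_summable_on mass_nonneg bdd_aboveI[of _ 1]) auto
  then show "infsum mass S \<le> 1"
    by (rule infsum_le_finite_sums) (use le in auto)
qed

text \<open>No mass is lost, thanks to countability: every point receives its own share of the error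
  e, and compactness leaves finitely many neighbourhoods to add up.\<close>

lemma infsum_mass_ge:
  assumes "countable S"
  shows "infsum mass S \<ge> 1"
proof -
  define n where "n = to_nat_on S"
  have bound: "1 \<le> (1 + e) * (infsum mass S + e)" if e: "e > 0" for e :: real
  proof -
    \<comment> \<open>\<open>n\<close> is injective on S, so these errors add up to at most e over
      any finite subset of S.\<close>
    have "\<exists>f. f \<in> admissible y \<and> I f < mass y + e * (1/2) ^ Suc (n y)" for y
      using mass_approx[of "e * (1/2) ^ Suc (n y)" y] e by auto
    then obtain f where f: "\<And>y. f y \<in> admissible y" "\<And>y. I (f y) < mass y + e * (1/2) ^ Suc (n y)"
      by metis
    have cont: "continuous_on S (f y)" for y using f(1)[of y] by (simp add: admissible_def)
    \<comment> \<open>The threshold is below 1 <= \<open>f y y\<close>, so the set is a relative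
      neighbourhood of y; on it (1 + e) times \<open>f y\<close> exceeds 1.\<close>
    have "\<forall>y. \<exists>U. open U \<and> U \<inter> S = (f y -` {1 / (1 + e)<..}) \<inter> S"
      using continuous_on_open_invariant[THEN iffD1, OF cont] by auto
    then obtain U where U: "\<And>y. open (U y)" "\<And>y. U y \<inter> S = (f y -` {1 / (1 + e)<..}) \<inter> S"
      by metis
    have "y \<in> U y" if "y \<in> S" for y
    proof -
      have "1 / (1 + e) < 1" "1 \<le> f y y" using e f(1)[of y] by (auto simp: admissible_def)
      then have "1 / (1 + e) < f y y" by linarith
      then show ?thesis using U(2)[of y] that by auto
    qed
    then have "S \<subseteq> (\<Union>y\<in>S. U y)" by auto
    then obtain F where F: "F \<subseteq> S" "finite F" "S \<subseteq> (\<Union>y\<in>F. U y)"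
      using compactE_image[OF compact, of S U] U(1) by auto
    have cont2: "continuous_on S (\<lambda>x. \<Sum>y\<in>F. f y x)" using cont by (intro continuous_on_sum) auto
    have "I (\<lambda>_. 1) \<le> I (\<lambda>x. (1 + e) * (\<Sum>y\<in>F. f y x))"
    proof (rule mono)
      fix x assume x: "x \<in> S"
      then obtain y where y: "y \<in> F" "x \<in> U y" using F by auto
      then have "1 / (1 + e) < f y x" using U(2)[of y] x by auto
      also have "f y x \<le> (\<Sum>y\<in>F. f y x)"
        using f(1) x by (intro member_le_sum) (auto simp: admissible_def y F)
      finally show "1 \<le> (1 + e) * (\<Sum>y\<in>F. f y x)" using e by (simp add: field_simps)
    qed (use cont2 in \<open>auto intro!: continuous_intros\<close>)
    also have "\<dots> = (1 + e) * (\<Sum>y\<in>F. I (f y))"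
      by (simp add: scale[OF cont2] finite_sum[OF F(2) cont])
    finally have "1 \<le> (1 + e) * (\<Sum>y\<in>F. I (f y))" by (simp add: one)
    also have "\<dots> \<le> (1 + e) * (\<Sum>y\<in>F. mass y + e * (1/2) ^ Suc (n y))"
      using e f(2) by (intro mult_left_mono sum_mono) (auto intro: less_imp_le)
    also have "(\<Sum>y\<in>F. mass y + e * (1/2) ^ Suc (n y)) = sum mass F + e * (\<Sum>y\<in>F. (1/2) ^ Suc (n y))"
      by (simp add: sum.distrib sum_distrib_left)
    finally have "1 \<le> (1 + e) * (sum mass F + e * (\<Sum>y\<in>F. (1/2) ^ Suc (n y)))" .
    moreover have "sum mass F \<le> infsum mass S"
      by (rule finite_sum_le_infsum) (use F mass_summable mass_nonneg in auto)
    moreover have "(\<Sum>y\<in>F. (1/2) ^ Suc (n y)) \<le> (1::real)"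
    proof -
      have inj: "inj_on n F"
        using inj_on_to_nat_on[OF assms] F(1) unfolding n_def by (rule inj_on_subset)
      have sums: "(\<lambda>k. (1/2::real) ^ Suc k) sums 1"
        using power_half_series by simp
      have "(\<Sum>y\<in>F. (1/2::real) ^ Suc (n y)) = (\<Sum>k\<in>n ` F. (1/2) ^ Suc k)"
        by (simp add: sum.reindex[OF inj])
      also have "\<dots> \<le> (\<Sum>k. (1/2) ^ Suc k)"
        by (rule sum_le_suminf) (use sums F in \<open>auto simp: sums_iff\<close>)
      finally show ?thesis using sums by (simp add: sums_iff)
    qed
    ultimately have "1 \<le> (1 + e) * (sum mass F + e * (\<Sum>y\<in>F. (1/2) ^ Suc (n y)))"
      "sum mass F + e * (\<Sum>y\<in>F. (1/2) ^ Suc (n y)) \<le> infsum mass S + e * 1"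
      using e by (auto intro!: add_mono mult_left_mono simp del: power_Suc)
    then show ?thesis
      using mult_left_mono[of "sum mass F + e * (\<Sum>y\<in>F. (1/2) ^ Suc (n y))"
          "infsum mass S + e" "1 + e"] e by linarith
  qed
  have "((\<lambda>e. (1 + e) * (infsum mass S + e)) \<longlongrightarrow> (1 + 0) * (infsum mass S + 0)) (at_right 0)"
    by (intro tendsto_intros)
  then have "1 \<le> (1 + 0) * (infsum mass S + 0)"
    by (rule tendsto_lowerbound) (use bound in \<open>auto simp: eventually_at_right_less eventually_at_filter\<close>)
  then show ?thesis by simp
qed

lemma ex_representing_pmf:
  assumes "countable S"
  shows "\<exists>p. set_pmf p \<subseteq> S \<and> (\<forall>f. continuous_on S f \<longrightarrow> measure_pmf.expectation p f = I f)"
proof -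
  have "infsum mass S = 1" using infsum_mass_ge[OF assms] mass_summable(2) by simp
  then have "(mass has_sum 1) S" using has_sum_infsum[OF mass_summable(1)] by simp
  then have m1: "((\<lambda>x. if x \<in> S then mass x else 0) has_sum 1) S"
    by (rule has_sum_cong[THEN iffD1, rotated]) simp
  have "\<exists>p. pmf p = (\<lambda>x. if x \<in> S then mass x else 0)"
    by (rule ex_pmf_of_has_sum[OF m1]) (auto simp: mass_nonneg)
  then obtain p where p: "pmf p = (\<lambda>x. if x \<in> S then mass x else 0)" by blast
  have supp: "set_pmf p \<subseteq> S" by (auto simp: set_pmf_iff p split: if_splits)
  have le: "measure_pmf.expectation p f \<le> I f"
    if f: "continuous_on S f" "\<And>x. x \<in> S \<Longrightarrow> 0 \<le> f x" for f
  proof -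
    obtain B where B: "\<And>x. x \<in> S \<Longrightarrow> \<bar>f x\<bar> \<le> B"
      using compact_continuous_bound[OF compact f(1)] by blast
    have "((\<lambda>x. pmf p x * f x) has_sum measure_pmf.expectation p f) S"
      by (rule has_sum_expectation[OF B supp])
    then show ?thesis
    proof (rule has_sum_le_finite_sums)
      fix F assume F: "finite F" "F \<subseteq> S"
      have "(\<Sum>x\<in>F. pmf p x * f x) = (\<Sum>x\<in>F. mass x * f x)"
        using F by (intro sum.cong) (auto simp: p)
      then show "(\<Sum>x\<in>F. pmf p x * f x) \<le> I f" using sum_mass_le[OF F f] by simp
    qed
  qed
  \<comment> \<open>The inequality for the nonnegative functions B + f and B - f gives both
    directions.\<close>
  have "measure_pmf.expectation p f = I f" if f: "continuous_on S f" for f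
  proof -
    obtain B where B: "\<And>x. x \<in> S \<Longrightarrow> \<bar>f x\<bar> \<le> B"
      using compact_continuous_bound[OF compact f] by blast
    note int = integrable_pmf_bounded_on[OF B supp]
    have cB: "continuous_on S (\<lambda>_. B)" "continuous_on S (\<lambda>x. - 1 * f x)"
      using f by (auto intro!: continuous_intros)
    have IB: "I (\<lambda>_. B) = B" using scale[of "\<lambda>_. 1" B] one by simp
    have "measure_pmf.expectation p (\<lambda>x. B + f x) \<le> I (\<lambda>x. B + f x)"
    proof (rule le)
      show "0 \<le> B + f x" if "x \<in> S" for x using B[OF that] by simp
    qed (intro continuous_intros f)
    moreover have "measure_pmf.expectation p (\<lambda>x. B + - 1 * f x) \<le> I (\<lambda>x. B + - 1 * f x)"
    proof (rule le)
      show "0 \<le> B + - 1 * f x" if "x \<in> S" for x using B[OF that] by simp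
    qed (intro continuous_intros f)
    ultimately show ?thesis
      using int by (simp add: add[OF cB(1) f] add[OF cB, simplified] scale[OF f, of "- 1", simplified] IB)
  qed
  then show ?thesis using supp by blast
qed

end

text \<open>Convergence is given on R only. Uniform density of R makes the expectations of every
  continuous function a Cauchy sequence, and their limits form a state.\<close>

lemma ex_weak_limit_pmf:
  fixes S :: "'a::metric_space set" and P :: "nat \<Rightarrow> 'a pmf"
  assumes ring: "function_ring_on R S" and count: "countable S"
    and supp: "\<And>n. set_pmf (P n) \<subseteq> S"
    and conv: "\<And>a. a \<in> R \<Longrightarrow> (\<lambda>n. measure_pmf.expectation (P n) a) \<longlonglongrightarrow> H a"
  shows "\<exists>p. set_pmf p \<subseteq> S \<and> (\<forall>a\<in>R. measure_pmf.expectation p a = H a)"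
proof -
  interpret R: function_ring_on R S by fact
  let ?E = "\<lambda>n f. measure_pmf.expectation (P n) f"
  have int: "integrable (measure_pmf (P n)) f" if f: "continuous_on S f" for f :: "'a \<Rightarrow> real" and n
  proof -
    obtain B where "\<And>x. x \<in> S \<Longrightarrow> \<bar>f x\<bar> \<le> B"
      using compact_continuous_bound[OF R.compact f] by blast
    then show ?thesis by (rule integrable_pmf_bounded_on[OF _ supp])
  qed
  have conv': "convergent (\<lambda>n. ?E n f)" if f: "continuous_on S f" for f :: "'a \<Rightarrow> real"
  proof (rule Cauchy_convergent[OF metric_CauchyI])
    fix e :: real assume e: "e > 0"
    then obtain a where a: "a \<in> R" "\<forall>x\<in>S. \<bar>f x - a x\<bar> < e / 3"
      using R.Stone_Weierstrass_basic[OF f, of "e / 3"] by auto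
    have close: "\<bar>?E n f - ?E n a\<bar> \<le> e / 3" for n
    proof (rule abs_expectation_diff_le[OF int[OF f] int[OF R.continuous[OF a(1)]]])
      show "\<bar>f x - a x\<bar> \<le> e / 3" if "x \<in> set_pmf (P n)" for x
        using a(2) supp[of n] that by (meson less_imp_le subsetD)
    qed
    have "Cauchy (\<lambda>n. ?E n a)" using conv[OF a(1)] LIMSEQ_imp_Cauchy by blast
    then obtain M where M: "\<And>m n. m \<ge> M \<Longrightarrow> n \<ge> M \<Longrightarrow> dist (?E m a) (?E n a) < e / 3"
      using metric_CauchyD[of "\<lambda>n. ?E n a" "e / 3"] e by auto
    show "\<exists>M. \<forall>m\<ge>M. \<forall>n\<ge>M. dist (?E m f) (?E n f) < e"
    proof (intro exI[of _ M] allI impI)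
      fix m n assume "m \<ge> M" "n \<ge> M"
      from M[OF this] close[of m] close[of n] show "dist (?E m f) (?E n f) < e"
        unfolding dist_real_def by linarith
    qed
  qed
  define I where "I f = lim (\<lambda>n. ?E n f)" for f :: "'a \<Rightarrow> real"
  have lim: "(\<lambda>n. ?E n f) \<longlonglongrightarrow> I f" if "continuous_on S f" for f :: "'a \<Rightarrow> real"
    using conv'[OF that] unfolding I_def by (simp add: convergent_LIMSEQ_iff)
  interpret positive_functional S I
  proof
    show "compact S" by (rule R.compact)
    fix f g :: "'a \<Rightarrow> real" and c :: real
    assume f: "continuous_on S f"
    show "I (\<lambda>x. c * f x) = c * I f"
    proof (rule LIMSEQ_unique)
      show "(\<lambda>n. ?E n (\<lambda>x. c * f x)) \<longlonglongrightarrow> I (\<lambda>x. c * f x)"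
        by (intro lim continuous_intros f)
      show "(\<lambda>n. ?E n (\<lambda>x. c * f x)) \<longlonglongrightarrow> c * I f"
        using tendsto_mult_left[OF lim[OF f], of c] by simp
    qed
    assume g: "continuous_on S g"
    show "I (\<lambda>x. f x + g x) = I f + I g"
    proof (rule LIMSEQ_unique)
      show "(\<lambda>n. ?E n (\<lambda>x. f x + g x)) \<longlonglongrightarrow> I (\<lambda>x. f x + g x)"
        by (intro lim continuous_intros f g)
      show "(\<lambda>n. ?E n (\<lambda>x. f x + g x)) \<longlonglongrightarrow> I f + I g"
        using tendsto_add[OF lim[OF f] lim[OF g]] by (simp add: int f g)
    qed
    assume fg: "\<And>x. x \<in> S \<Longrightarrow> f x \<le> g x"
    have "?E n f \<le> ?E n g" for n
      by (rule integral_mono_AE) (use int f g fg supp[of n] in \<open>auto simp: AE_measure_pmf_iff\<close>)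
    then show "I f \<le> I g"
      by (intro LIMSEQ_le[OF lim[OF f] lim[OF g]]) auto
  next
    show "I (\<lambda>_. 1) = 1"
      by (rule LIMSEQ_unique[OF lim]) auto
  qed
  obtain p where p: "set_pmf p \<subseteq> S" "\<And>f. continuous_on S f \<Longrightarrow> measure_pmf.expectation p f = I f"
    using ex_representing_pmf[OF count] by blast
  have "I a = H a" if "a \<in> R" for a
    by (rule LIMSEQ_unique[OF lim[OF R.continuous[OF that]] conv[OF that]])
  then show ?thesis using p(1) p(2)[OF R.continuous] by auto
qed

section \<open>Extension of the one-step kernel to the closure\<close>

lemma poly_prod_linear: "poly (\<Prod>i\<in>A. [:- Y i, 1:]) t = (\<Prod>i\<in>A. t - Y i)"
  for Y :: "'i \<Rightarrow> real"
  by (simp add: poly_prod)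

text \<open>The last entry of either list is the largest root of the common polynomial; after
  cancelling its linear factor, induction applies.\<close>

lemma sorted_eq_of_prod_eq:
  fixes Y Y' :: "nat \<Rightarrow> real"
  assumes "\<And>i j. i \<le> j \<Longrightarrow> j < N \<Longrightarrow> Y i \<le> Y j" "\<And>i j. i \<le> j \<Longrightarrow> j < N \<Longrightarrow> Y' i \<le> Y' j"
    and "\<And>t. (\<Prod>i<N. t - Y i) = (\<Prod>i<N. t - Y' i)" "i < N"
  shows "Y i = Y' i"
  using assms
proof (induction N)
  case (Suc N)
  have top: "Z N = Z' N \<or> Z N < Z' N" if
    "\<And>i j. i \<le> j \<Longrightarrow> j < Suc N \<Longrightarrow> Z' i \<le> Z' j"
    "\<And>t. (\<Prod>i<Suc N. t - Z i) = (\<Prod>i<Suc N. t - Z' i)" for Z Z' :: "nat \<Rightarrow> real"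
  proof -
    have "(\<Prod>i<Suc N. Z N - Z' i) = 0" using that(2)[of "Z N"] by simp
    then obtain i where "i < Suc N" "Z N = Z' i"
      unfolding prod_zero_iff[OF finite_lessThan] by auto
    then show ?thesis using that(1)[of i N] by auto
  qed
  have last: "Y N = Y' N"
    using top[of Y' Y] top[of Y Y'] Suc.prems by fastforce
  \<comment> \<open>The cancellation takes place in the polynomial ring, because pointwise it would
    fail at t = \<open>Y N\<close>.\<close>
  have "(\<Prod>i<N. [:- Y i, 1:]) * [:- Y N, 1:] = (\<Prod>i<N. [:- Y' i, 1:]) * [:- Y N, 1:]"
    unfolding poly_eq_poly_eq_iff[symmetric]
  proof
    fix t
    show "poly ((\<Prod>i<N. [:- Y i, 1:]) * [:- Y N, 1:]) t
        = poly ((\<Prod>i<N. [:- Y' i, 1:]) * [:- Y N, 1:]) t"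
      using Suc.prems(3)[of t] last by (simp add: poly_prod_linear del: mult_cancel_right mult_pCons_right)
  qed
  then have "(\<Prod>i<N. [:- Y i, 1:]) = (\<Prod>i<N. [:- Y' i, 1:])"
    by (rule mult_right_cancel[THEN iffD1, rotated]) simp
  then have "(\<Prod>i<N. t - Y i) = (\<Prod>i<N. t - Y' i)" for t
    by (metis poly_prod_linear)
  then show ?case
    using Suc.IH Suc.prems last by (cases "i = N") auto
qed simp

lemma closed_cone: "closed (cone M)"
proof -
  have "cone M = (\<Inter>i\<in>{..<M}. \<Inter>j\<in>{i<..<M}. {a. a i \<le> a j}) \<inter> (\<Inter>i\<in>{M..}. {a. a i = 0})"
    unfolding cone_def by auto
  then show ?thesis
    by (simp only:) (intro closed_Int closed_INT ballI closed_Collect_le closed_Collect_eq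
        continuous_on_coordinate continuous_on_const)
qed

lemma integrable_pmf_continuous_compact:
  fixes f :: "'a::topological_space \<Rightarrow> real"
  assumes "compact S" "continuous_on S f" "set_pmf p \<subseteq> S"
  shows "integrable (measure_pmf p) f"
proof -
  obtain B where "\<And>x. x \<in> S \<Longrightarrow> \<bar>f x\<bar> \<le> B"
    using compact_continuous_bound[OF assms(1,2)] by blast
  then show ?thesis by (rule integrable_pmf_bounded_on[OF _ assms(3)])
qed

context q_lattice
begin

section \<open>Topology of the closed configuration space\<close>

lemma Gbar_eq_closure: "Gbar N = closure (G N)"
proof -
  have "G N \<subseteq> cone N" unfolding conf_def cone_def by (auto intro: less_imp_le)
  then have "closure (G N) \<subseteq> cone N" by (rule closure_minimal[OF _ closed_cone])
  then show ?thesis unfolding conf_closure_def by auto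
qed

lemma G_subset_Gbar: "G N \<subseteq> Gbar N"
  unfolding Gbar_eq_closure by (rule closure_subset)

lemma GbarD:
  assumes "X \<in> Gbar N"
  shows "i \<le> j \<Longrightarrow> j < N \<Longrightarrow> X i \<le> X j" "N \<le> i \<Longrightarrow> X i = 0"
  using assms unfolding conf_closure_def cone_def by (auto simp: le_less)

lemma closed_insert_0_ray: "closed (insert 0 (ray a))"
proof -
  have "(\<lambda>n. a * q ^ n) \<longlonglongrightarrow> 0"
    using q_pos q_less_1 by (intro tendsto_mult_right_zero LIMSEQ_power_zero) auto
  from compact_sequence_with_limit[OF this] show ?thesis
    unfolding ray_def by (rule compact_imp_closed)
qed

lemma lattice_point_beyond:
  obtains a b where "a \<in> L" "b \<in> L" "b < - R" "R < a" "b < 0" "0 < a"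
proof -
  have "\<exists>n. \<bar>R\<bar> < c * (1 / q) ^ n" if "c > 0" for c
  proof -
    obtain n where "\<bar>R\<bar> / c < (1 / q) ^ n"
      using real_arch_pow[of "1 / q" "\<bar>R\<bar> / c"] q_pos q_less_1 by auto
    then show ?thesis using that by (auto simp: field_simps)
  qed
  from this[of zp] this[of "- zm"] zp_pos zm_neg obtain m n where
    *: "\<bar>R\<bar> < zp * (1 / q) ^ m" "\<bar>R\<bar> < - zm * (1 / q) ^ n" by auto
  show ?thesis
  proof
    show "zp * q powi (- int m) \<in> L" "zm * q powi (- int n) \<in> L"
      unfolding lattice_pts_def by blast+
    show "zm * q powi (- int n) < - R" "R < zp * q powi (- int m)"
      "zm * q powi (- int n) < 0" "0 < zp * q powi (- int m)"
      using * by (auto simp: power_int_minus inverse_eq_divide power_one_over)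
  qed
qed

text \<open>A local question: inside a bounded window around x the set lies in two rays completed by
  their limit \<open>0\<close>.\<close>

lemma closed_lattice: "closed (insert 0 L)"
  unfolding closure_subset_eq[symmetric]
proof
  fix x assume x: "x \<in> closure (insert 0 L)"
  obtain a b where ab: "a \<in> L" "b \<in> L" "b < - \<bar>x\<bar>" "\<bar>x\<bar> < a" "b < 0" "0 < a"
    by (rule lattice_point_beyond)
  have "x \<in> {b<..<a} \<inter> closure (insert 0 L)" using ab x by auto
  also have "\<dots> \<subseteq> closure ({b<..<a} \<inter> insert 0 L)"
    by (rule open_Int_closure_subset) simp
  also have "\<dots> \<subseteq> insert 0 (ray a) \<union> insert 0 (ray b)"
  proof (rule closure_minimal)
    show "closed (insert 0 (ray a) \<union> insert 0 (ray b))"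
      by (intro closed_Un closed_insert_0_ray)
    show "{b<..<a} \<inter> insert 0 L \<subseteq> insert 0 (ray a) \<union> insert 0 (ray b)"
      using ab ray_pos[of a, symmetric] ray_neg[of b, symmetric] by force
  qed
  finally show "x \<in> insert 0 L"
    using ab ray_pos[of a, symmetric] ray_neg[of b, symmetric] by auto
qed

lemma Gbar_values:
  assumes "X \<in> Gbar N" "i < N"
  shows "X i \<in> insert 0 L"
proof -
  have "closed ((\<lambda>X::nat \<Rightarrow> real. X i) -` insert 0 L)"
    by (rule closed_vimage[OF closed_lattice continuous_on_coordinate])
  moreover have "G N \<subseteq> (\<lambda>X. X i) -` insert 0 L"
    using assms(2) confD(1) by auto
  ultimately have "Gbar N \<subseteq> (\<lambda>X. X i) -` insert 0 L"
    unfolding Gbar_eq_closure by (rule closure_minimal[rotated])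
  then show ?thesis using assms(1) by auto
qed

lemma countable_Gbar: "countable (Gbar N)"
proof -
  have "countable L" unfolding lattice_pts_def by simp
  then have "countable (PiE {..<N} (\<lambda>_. insert 0 L))" by (intro countable_PiE) auto
  moreover have "Gbar N \<subseteq> (\<lambda>f i. if i < N then f i else 0) ` PiE {..<N} (\<lambda>_. insert 0 L)"
  proof
    fix X assume X: "X \<in> Gbar N"
    have "X = (\<lambda>i. if i < N then restrict X {..<N} i else 0)"
      using GbarD(2)[OF X] by (auto simp: fun_eq_iff)
    moreover have "restrict X {..<N} \<in> PiE {..<N} (\<lambda>_. insert 0 L)"
      using Gbar_values[OF X] by auto
    ultimately show "X \<in> (\<lambda>f i. if i < N then f i else 0) ` PiE {..<N} (\<lambda>_. insert 0 L)" by blast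
  qed
  ultimately show ?thesis using countable_image countable_subset by blast
qed

definition Gbox :: "nat \<Rightarrow> real \<Rightarrow> (nat \<Rightarrow> real) set" where
  "Gbox N R = {Y \<in> Gbar N. \<forall>i<N. \<bar>Y i\<bar> \<le> R}"

lemma Gbox_subset: "Gbox N R \<subseteq> Gbar N" and Gbox_mono: "R \<le> R' \<Longrightarrow> Gbox N R \<subseteq> Gbox N R'"
  unfolding Gbox_def by auto

lemma compact_Gbox: "compact (Gbox N R)"
proof -
  let ?K = "PiE UNIV (\<lambda>i. if i < N then {-R..R} else {0})"
  have "compactin (product_topology (\<lambda>_. euclidean) UNIV) ?K"
    unfolding compactin_PiE by auto
  then have "compact ?K" by (simp add: euclidean_product_topology)
  moreover have "Gbox N R = Gbar N \<inter> ?K"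
    unfolding Gbox_def using GbarD(2) by (auto simp: PiE_def Pi_def abs_le_iff split: if_splits)
  ultimately show ?thesis
    unfolding Gbar_eq_closure by (simp add: closed_Int_compact)
qed

text \<open>With \<open>compact_Gbox\<close>, this lets vanishing at infinity be tested on boxes.
  The sum of absolute values is one continuous function dominating all coordinates.\<close>

lemma compact_subset_Gbox:
  assumes "compact C" "C \<subseteq> Gbar N"
  obtains R where "R > 0" "C \<subseteq> Gbox N R"
proof -
  have "continuous_on C (\<lambda>Y. \<Sum>i<N. \<bar>Y i\<bar>)"
    by (intro continuous_intros continuous_on_coordinate)
  from compact_continuous_bound[OF assms(1) this] obtain R where
    R: "R > 0" "\<And>Y. Y \<in> C \<Longrightarrow> \<bar>\<Sum>i<N. \<bar>Y i\<bar>\<bar> \<le> R" by blast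
  have "\<bar>Y i\<bar> \<le> R" if "Y \<in> C" "i < N" for Y i
  proof -
    have "\<bar>Y i\<bar> \<le> (\<Sum>i<N. \<bar>Y i\<bar>)" by (rule member_le_sum) (use that in auto)
    then show ?thesis using R(2)[OF that(1)] by simp
  qed
  then have "C \<subseteq> Gbox N R" using assms(2) by (auto simp: Gbox_def)
  then show ?thesis using that R(1) by blast
qed

text \<open>
  Linear combinations of the functions \<open>\<Prod>\<^sub>i p(y\<^sub>i)\<close>. They separate configurations because
  \<open>\<Prod>\<^sub>i (t - y\<^sub>i)\<close> determines the configuration.
\<close>

inductive_set symmetric_products :: "nat \<Rightarrow> ((nat \<Rightarrow> real) \<Rightarrow> real) set" for N where
  product: "(\<lambda>Y. c * (\<Prod>i<N. poly p (Y i))) \<in> symmetric_products N"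
| sum: "f \<in> symmetric_products N \<Longrightarrow> g \<in> symmetric_products N
    \<Longrightarrow> (\<lambda>Y. f Y + g Y) \<in> symmetric_products N"

text \<open>Taking the same polynomial at every point is multiplicative: the products for p and p'
  multiply to the product for \<open>p * p'\<close>.\<close>

lemma symmetric_products_mult:
  assumes "f \<in> symmetric_products N" "g \<in> symmetric_products N"
  shows "(\<lambda>Y. f Y * g Y) \<in> symmetric_products N"
  using assms(1)
proof induction
  case (product c p)
  show ?case
    using assms(2)
  proof induction
    case (product c' p')
    have "(\<lambda>Y. (c * c') * (\<Prod>i<N. poly (p * p') (Y i))) \<in> symmetric_products N"
      by (rule symmetric_products.product)
    then show ?case by (simp add: prod.distrib ac_simps)
  next
    case (sum f g)
    then show ?case by (simp add: distrib_left symmetric_products.sum)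
  qed
next
  case (sum f g)
  then show ?case by (simp add: distrib_right symmetric_products.sum)
qed

lemma continuous_on_symmetric_products:
  "f \<in> symmetric_products N \<Longrightarrow> continuous_on S f"
  by (induction rule: symmetric_products.induct)
    (auto intro!: continuous_intros continuous_on_coordinate)

lemma function_ring_symmetric_products: "function_ring_on (symmetric_products N) (Gbox N R)"
proof
  show "compact (Gbox N R)" by (rule compact_Gbox)
  show "(\<lambda>_. c) \<in> symmetric_products N" for c
    using symmetric_products.product[of c 1 N] by simp
  show "\<exists>f\<in>symmetric_products N. f Y \<noteq> f Y'" if "Y \<in> Gbox N R" "Y' \<in> Gbox N R" "Y \<noteq> Y'" for Y Y'
  proof (rule ccontr)
    assume contra: "\<not> ?thesis"
    have Y: "Y \<in> Gbar N" "Y' \<in> Gbar N" using that Gbox_subset by auto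
    have "(\<Prod>i<N. t - Y i) = (\<Prod>i<N. t - Y' i)" for t
    proof -
      \<comment> \<open>As a polynomial in y, \<open>[:t, -1:]\<close> is t - y.\<close>
      have "(\<lambda>Y. 1 * (\<Prod>i<N. poly [:t, -1:] (Y i))) \<in> symmetric_products N"
        by (rule symmetric_products.product)
      then show ?thesis using contra by force
    qed
    then have "Y i = Y' i" if "i < N" for i
      using sorted_eq_of_prod_eq[of N Y Y' i] GbarD(1)[OF Y(1)] GbarD(1)[OF Y(2)] that by blast
    then have "Y = Y'" using GbarD(2)[OF Y(1)] GbarD(2)[OF Y(2)]
      by (metis ext not_less)
    then show False using that by simp
  qed
qed (auto intro: continuous_on_symmetric_products symmetric_products_mult symmetric_products.sum)

text \<open>A bound on the coordinates that is continuous in X, so that a single box serves a whole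
  neighbourhood.\<close>

definition reach :: "nat \<Rightarrow> (nat \<Rightarrow> real) \<Rightarrow> real" where
  "reach N X = 1 + (\<Sum>i\<le>N. \<bar>X i\<bar>)"

lemma continuous_on_reach: "continuous_on S (reach N)"
  unfolding reach_def by (intro continuous_intros continuous_on_coordinate)

lemma interlaces_in_Gbox:
  assumes "interlaces q zp zm N Y X"
  shows "Y \<in> Gbox N (reach N X)"
proof -
  have "\<bar>Y i\<bar> \<le> reach N X" if i: "i < N" for i
  proof -
    have "X i \<le> Y i" "Y i \<le> X (Suc i)"
      using assms i lattice_interval_bounds[of "Y i"] unfolding interlaces_def by auto
    moreover have "\<bar>X i\<bar> \<le> (\<Sum>i\<le>N. \<bar>X i\<bar>)" "\<bar>X (Suc i)\<bar> \<le> (\<Sum>i\<le>N. \<bar>X i\<bar>)"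
      by (rule member_le_sum; use i in simp)+
    ultimately show ?thesis unfolding reach_def by linarith
  qed
  then show ?thesis
    using assms G_subset_Gbar unfolding interlaces_def Gbox_def by auto
qed

lemma set_link_pmf_Gbox: "X \<in> G (Suc N) \<Longrightarrow> set_pmf (link_pmf N X) \<subseteq> Gbox N (reach N X)"
  using set_link_pmf interlaces_in_Gbox by blast

lemma expectation_symmetric_products:
  assumes "f \<in> symmetric_products N"
  shows "\<exists>H. continuous_on UNIV H \<and>
    (\<forall>X\<in>G (Suc N). measure_pmf.expectation (link_pmf N X) f = H X)"
  using assms
proof induction
  case (product c p)
  show ?case
  proof (intro exI conjI ballI)
    show "continuous_on UNIV (\<lambda>X. c * (qpoch q q N * power_det N p X))"
      by (intro continuous_intros continuous_on_power_det)
  qed (simp add: expectation_link_pmf)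
next
  case (sum f g)
  then obtain H H' where H: "continuous_on UNIV H" "continuous_on UNIV H'"
    "\<And>X. X \<in> G (Suc N) \<Longrightarrow> measure_pmf.expectation (link_pmf N X) f = H X"
    "\<And>X. X \<in> G (Suc N) \<Longrightarrow> measure_pmf.expectation (link_pmf N X) g = H' X" by blast
  have int: "integrable (measure_pmf (link_pmf N X)) f"
    if "f \<in> symmetric_products N" "X \<in> G (Suc N)" for f X
    by (rule integrable_pmf_continuous_compact[OF compact_Gbox
        continuous_on_symmetric_products[OF that(1)] set_link_pmf_Gbox[OF that(2)]])
  show ?case
  proof (intro exI conjI ballI)
    show "continuous_on UNIV (\<lambda>X. H X + H' X)" by (intro continuous_intros H)
  qed (use int sum.hyps H in simp)
qed

text \<open>A function f may have several representations by products; the choice depends on f alone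
  and yields one continuous function for all X. By density its values on the closure are
  determined.\<close>

definition limit_value :: "nat \<Rightarrow> ((nat \<Rightarrow> real) \<Rightarrow> real) \<Rightarrow> (nat \<Rightarrow> real) \<Rightarrow> real" where
  "limit_value N f = (SOME H. continuous_on UNIV H \<and>
    (\<forall>X\<in>G (Suc N). measure_pmf.expectation (link_pmf N X) f = H X))"

lemma limit_value:
  assumes "f \<in> symmetric_products N"
  shows "continuous_on UNIV (limit_value N f)"
    "X \<in> G (Suc N) \<Longrightarrow> measure_pmf.expectation (link_pmf N X) f = limit_value N f X"
  using someI_ex[OF expectation_symmetric_products[OF assms]] unfolding limit_value_def by auto

lemma ex_limit_pmf:
  assumes X: "X \<in> Gbar (Suc N)"
  shows "\<exists>p. set_pmf p \<subseteq> Gbox N (1 + reach N X) \<and>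
    (\<forall>f\<in>symmetric_products N. measure_pmf.expectation p f = limit_value N f X)"
proof -
  obtain x where x: "\<And>n. x n \<in> G (Suc N)" "x \<longlonglongrightarrow> X"
    using X unfolding Gbar_eq_closure closure_sequential by blast
  have "(\<lambda>n. reach N (x n)) \<longlonglongrightarrow> reach N X"
    by (rule continuous_on_tendsto_compose[OF continuous_on_reach[of UNIV] x(2)]) auto
  \<comment> \<open>Dropping finitely many terms puts all supports into one compact box, of radius
    \<open>1 + reach N X\<close>.\<close>
  then have "\<forall>\<^sub>F n in sequentially. reach N (x n) < 1 + reach N X"
    by (rule order_tendstoD) simp
  then obtain m where m: "\<And>n. n \<ge> m \<Longrightarrow> reach N (x n) < 1 + reach N X"
    unfolding eventually_sequentially by blast
  show ?thesis
  proof (rule ex_weak_limit_pmf[OF function_ring_symmetric_products])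
    show "countable (Gbox N (1 + reach N X))"
      using countable_Gbar Gbox_subset by (rule countable_subset[rotated])
    show "set_pmf (link_pmf N (x (n + m))) \<subseteq> Gbox N (1 + reach N X)" for n
      using set_link_pmf_Gbox[OF x(1)] Gbox_mono[OF less_imp_le[OF m[of "n + m"]]] by fastforce
    fix f assume f: "f \<in> symmetric_products N"
    have "(\<lambda>n. limit_value N f (x (n + m))) \<longlonglongrightarrow> limit_value N f X"
      by (rule continuous_on_tendsto_compose[OF limit_value(1)[OF f] LIMSEQ_ignore_initial_segment[OF x(2)]])
        auto
    then show "(\<lambda>n. measure_pmf.expectation (link_pmf N (x (n + m))) f) \<longlonglongrightarrow> limit_value N f X"
      by (simp add: limit_value(2)[OF f x(1)])
  qed
qed

definition ext_pmf :: "nat \<Rightarrow> (nat \<Rightarrow> real) \<Rightarrow> (nat \<Rightarrow> real) pmf" where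
  "ext_pmf N X = (if X \<in> G (Suc N) then link_pmf N X else
    (SOME p. set_pmf p \<subseteq> Gbox N (1 + reach N X) \<and>
      (\<forall>f\<in>symmetric_products N. measure_pmf.expectation p f = limit_value N f X)))"

lemma ext_pmf:
  assumes "X \<in> Gbar (Suc N)"
  shows "set_pmf (ext_pmf N X) \<subseteq> Gbox N (1 + reach N X)"
    "f \<in> symmetric_products N \<Longrightarrow> measure_pmf.expectation (ext_pmf N X) f = limit_value N f X"
  using someI_ex[OF ex_limit_pmf[OF assms]] limit_value(2)[of f N X]
    set_link_pmf_Gbox[of X N] Gbox_mono[of "reach N X" "1 + reach N X" N]
  unfolding ext_pmf_def by auto

text \<open>On a box f is uniformly close to a combination of products, whose averages are
  continuous; a three-epsilon argument does the rest.\<close>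

lemma continuous_on_expectation_ext_pmf:
  fixes f :: "(nat \<Rightarrow> real) \<Rightarrow> real"
  assumes f: "continuous_on (Gbar N) f"
  shows "continuous_on (Gbar (Suc N)) (\<lambda>X. measure_pmf.expectation (ext_pmf N X) f)"
  unfolding continuous_on_def
proof (rule ballI, rule tendstoI)
  fix X and e :: real
  assume X: "X \<in> Gbar (Suc N)" and e: "e > 0"
  let ?E = "\<lambda>X. measure_pmf.expectation (ext_pmf N X)"
  \<comment> \<open>One unit allows \<open>reach\<close> to vary near X, the other is the margin in
    the support bound of \<open>ext_pmf\<close>.\<close>
  let ?B = "Gbox N (2 + reach N X)"
  interpret R: function_ring_on "symmetric_products N" ?B
    by (rule function_ring_symmetric_products)
  have fB: "continuous_on ?B f" using f Gbox_subset by (rule continuous_on_subset)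
  obtain a where a: "a \<in> symmetric_products N" "\<And>Y. Y \<in> ?B \<Longrightarrow> \<bar>f Y - a Y\<bar> < e / 3"
    using R.Stone_Weierstrass_basic[OF fB, of "e / 3"] e by auto
  have close: "\<bar>?E Z f - limit_value N a Z\<bar> \<le> e / 3" if Z: "Z \<in> Gbar (Suc N)" "reach N Z < 1 + reach N X" for Z
  proof -
    have supp: "set_pmf (ext_pmf N Z) \<subseteq> ?B"
      using ext_pmf(1)[OF Z(1)] Gbox_mono[of "1 + reach N Z" "2 + reach N X"] Z(2) by force
    have int: "integrable (measure_pmf (ext_pmf N Z)) g" if "continuous_on ?B g" for g :: "(nat \<Rightarrow> real) \<Rightarrow> real"
      by (rule integrable_pmf_continuous_compact[OF compact_Gbox that supp])
    have "\<bar>?E Z f - ?E Z a\<bar> \<le> e / 3"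
      by (rule abs_expectation_diff_le[OF int[OF fB] int[OF continuous_on_symmetric_products[OF a(1)]]])
        (use a(2) supp in force)
    then show ?thesis by (simp add: ext_pmf(2)[OF Z(1) a(1)])
  qed
  have "(limit_value N a \<longlongrightarrow> limit_value N a X) (at X within Gbar (Suc N))"
    using continuous_on_subset[OF limit_value(1)[OF a(1)], of "Gbar (Suc N)"] X
    by (simp add: continuous_on_def)
  then have ev1: "\<forall>\<^sub>F Z in at X within Gbar (Suc N). dist (limit_value N a Z) (limit_value N a X) < e / 3"
    using e by (intro tendstoD) auto
  have "(reach N \<longlongrightarrow> reach N X) (at X within Gbar (Suc N))"
    using continuous_on_reach[of "Gbar (Suc N)" N] X by (simp add: continuous_on_def)
  then have ev2: "\<forall>\<^sub>F Z in at X within Gbar (Suc N). reach N Z < 1 + reach N X"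
    by (rule order_tendstoD) simp
  have ev3: "\<forall>\<^sub>F Z in at X within Gbar (Suc N). Z \<in> Gbar (Suc N)"
    by (simp add: eventually_at_filter)
  show "\<forall>\<^sub>F Z in at X within Gbar (Suc N). dist (?E Z f) (?E X f) < e"
    using ev1 ev2 ev3
  proof eventually_elim
    case (elim Z)
    then show ?case
      using close[of Z] close[OF X] unfolding dist_real_def by linarith
  qed
qed

end

section \<open>The Feller property of one step\<close>

lemma prod_le_power_abs:
  fixes f :: "nat \<Rightarrow> real"
  assumes "\<And>i. i < n \<Longrightarrow> \<bar>f i\<bar> \<le> b"
  shows "\<bar>\<Prod>i<n. f i\<bar> \<le> b ^ n"
proof -
  have "(\<Prod>i<n. \<bar>f i\<bar>) \<le> (\<Prod>i<n. b)" by (rule prod_mono) (use assms in auto)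
  then show ?thesis by (simp add: abs_prod)
qed

lemma power_le_prod_abs:
  fixes f :: "nat \<Rightarrow> real"
  assumes "0 \<le> b" "\<And>i. i < n \<Longrightarrow> b \<le> \<bar>f i\<bar>"
  shows "b ^ n \<le> \<bar>\<Prod>i<n. f i\<bar>"
proof -
  have "(\<Prod>i<n. b) \<le> (\<Prod>i<n. \<bar>f i\<bar>)" by (rule prod_mono) (use assms in auto)
  then show ?thesis by (simp add: abs_prod)
qed

lemma C0_bounded:
  assumes "f \<in> C0 S"
  obtains B where "B > 0" "\<And>x. x \<in> S \<Longrightarrow> \<bar>f x\<bar> \<le> B"
proof -
  have "\<forall>e>0. \<exists>C. compact C \<and> C \<subseteq> S \<and> (\<forall>x\<in>S - C. \<bar>f x\<bar> < e)"
    using assms by (simp add: C0_def)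
  from this[rule_format, of 1]
  obtain C where C: "compact C" "C \<subseteq> S" "\<forall>x\<in>S - C. \<bar>f x\<bar> < 1" by auto
  have "continuous_on C f"
    using assms C(2) continuous_on_subset unfolding C0_def by blast
  then obtain B where B: "\<And>x. x \<in> C \<Longrightarrow> \<bar>f x\<bar> \<le> B"
    using compact_continuous_bound[OF C(1)] by blast
  show ?thesis
  proof
    show "max 1 B > 0" by simp
    show "\<bar>f x\<bar> \<le> max 1 B" if "x \<in> S" for x
      using B[of x] C(3)[rule_format, of x] that by (cases "x \<in> C") auto
  qed
qed

lemma vandermonde_split_last:
  "vandermonde (Suc n) a = vandermonde n (a(n := c)) * (\<Prod>i<n. a i - a n)"
proof -
  have "vandermonde n (a(n := c)) = vandermonde n a"
    unfolding vandermonde_def by (intro prod.cong refl) auto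
  then show ?thesis by (simp add: vandermonde_def)
qed

lemma vandermonde_split_first:
  "vandermonde (Suc n) a = vandermonde n (\<lambda>i. a (Suc i)) * (\<Prod>i<n. a 0 - a (Suc i))"
  unfolding vandermonde_def
  by (simp add: prod.lessThan_Suc_shift prod.distrib mult.commute del: prod.lessThan_Suc)

context q_lattice
begin

text \<open>The weights |y| decay geometrically towards the accumulation point \<open>0\<close>. The
  constant A bounds the total weight of the dropped point of Y.\<close>

lemma finite_lattice_sum_bound:
  obtains A where "A \<ge> 0" "\<And>F. finite F \<Longrightarrow> F \<subseteq> L \<inter> {-R..R} \<Longrightarrow> (\<Sum>y\<in>F. \<bar>y\<bar>) \<le> A"
proof -
  obtain a b where ab: "a \<in> L" "b \<in> L" "b < - R" "R < a" "b < 0" "0 < a"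
    by (rule lattice_point_beyond)
  have "ray a \<inter> ray b = {}"
    using ab ray_pos[of a, symmetric] ray_neg[of b, symmetric] by auto
  then obtain A where A: "((\<lambda>y. \<bar>y\<bar>) has_sum A) (ray a \<union> ray b)"
    using has_sum_Un_disjoint[OF has_sum_ray[of a 1] has_sum_ray[of b 1]] ab by auto
  show ?thesis
  proof
    show "A \<ge> 0" using has_sum_nonneg[OF A] by simp
    fix F assume F: "finite F" "F \<subseteq> L \<inter> {-R..R}"
    have "F \<subseteq> ray a \<union> ray b"
    proof
      fix y assume "y \<in> F"
      then have "y \<in> L" "y \<noteq> 0" "b \<le> y" "y \<le> a" using F ab zero_notin_lattice by auto
      then show "y \<in> ray a \<union> ray b"
        using ab ray_pos[of a, symmetric] ray_neg[of b, symmetric] by auto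
    qed
    then show "(\<Sum>y\<in>F. \<bar>y\<bar>) \<le> A" by (intro finite_sum_le_has_sum[OF A F(1)]) auto
  qed
qed

text \<open>Dropping a point in abstract form: \<open>\<Phi>\<close> removes it from Y,
  \<open>\<phi>\<close> records it, and together they determine Y. Summing over all pairs gives at
  most the mass of the lower kernel times the weight A, times c.\<close>

lemma prob_Gbox_le:
  assumes X: "X \<in> G (Suc N)" "X' \<in> G (Suc M)" and c: "c \<ge> 0"
    and A: "\<And>F. finite F \<Longrightarrow> F \<subseteq> L \<inter> {-R..R} \<Longrightarrow> (\<Sum>y\<in>F. \<bar>y\<bar>) \<le> A"
    and S: "S = {Y. interlaces q zp zm N Y X \<and> (\<forall>i<N. \<bar>Y i\<bar> \<le> R)}"
    and inj: "inj_on (\<lambda>Y. (\<Phi> Y, \<phi> Y)) S" and \<phi>: "\<And>Y. Y \<in> S \<Longrightarrow> \<phi> Y \<in> L \<inter> {-R..R}"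
    and le: "\<And>Y. Y \<in> S \<Longrightarrow>
      link_step q zp zm N X Y \<le> link_step q zp zm M X' (\<Phi> Y) * \<bar>\<phi> Y\<bar> * c"
  shows "measure_pmf.prob (link_pmf N X) (Gbox N R) \<le> A * c"
proof -
  let ?l = "link_step q zp zm M X'"
  have abs: "Infinite_Set_Sum.abs_summable_on (pmf (link_pmf N X)) (Gbox N R)" by auto
  then have "pmf (link_pmf N X) summable_on Gbox N R"
    using abs_summable_equivalent Infinite_Sum.abs_summable_summable by blast
  then have "infsum (pmf (link_pmf N X)) (Gbox N R) \<le> A * c"
  proof (rule infsum_le_finite_sums)
    fix F assume F: "finite F" "F \<subseteq> Gbox N R"
    let ?F = "F \<inter> S"
    have "sum (pmf (link_pmf N X)) F = sum (link_step q zp zm N X) ?F"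
      unfolding pmf_link_pmf[OF X(1)]
      by (rule sum.mono_neutral_right) (use F in \<open>auto simp: link_step_def S Gbox_def\<close>)
    also have "\<dots> \<le> (\<Sum>Y\<in>?F. ?l (\<Phi> Y) * \<bar>\<phi> Y\<bar> * c)"
      by (rule sum_mono) (use le in auto)
    also have "\<dots> = (\<Sum>(Z, y)\<in>(\<lambda>Y. (\<Phi> Y, \<phi> Y)) ` ?F. ?l Z * \<bar>y\<bar> * c)"
      by (subst sum.reindex) (auto intro: inj_on_subset[OF inj])
    \<comment> \<open>Enlarging the set of pairs to a rectangle decouples the two sums; all terms
      are nonnegative.\<close>
    also have "\<dots> \<le> (\<Sum>(Z, y)\<in>\<Phi> ` ?F \<times> \<phi> ` ?F. ?l Z * \<bar>y\<bar> * c)"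
      by (rule sum_mono2) (use F c link_step_nonneg in \<open>auto intro!: mult_nonneg_nonneg\<close>)
    also have "\<dots> = (\<Sum>Z\<in>\<Phi> ` ?F. ?l Z) * (\<Sum>y\<in>\<phi> ` ?F. \<bar>y\<bar>) * c"
      by (simp only: sum.cartesian_product[symmetric] sum_distrib_left[symmetric]
          sum_distrib_right[symmetric])
    also have "\<dots> \<le> 1 * A * c"
    proof (intro mult_right_mono mult_mono c)
      have "(\<Sum>Z\<in>\<Phi> ` ?F. ?l Z) = measure_pmf.prob (link_pmf M X') (\<Phi> ` ?F)"
        using F(1) by (subst measure_measure_pmf_finite) (auto simp: pmf_link_pmf[OF X(2)])
      then show "(\<Sum>Z\<in>\<Phi> ` ?F. ?l Z) \<le> 1" by simp
      show "(\<Sum>y\<in>\<phi> ` ?F. \<bar>y\<bar>) \<le> A" using F(1) \<phi> by (intro A) auto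
    qed (auto intro: sum_nonneg)
    finally show "sum (pmf (link_pmf N X)) F \<le> A * c" by simp
  qed
  then show ?thesis
    unfolding measure_pmf_conv_infsetsum using infsetsum_infsum[OF abs] by simp
qed

text \<open>The dropped points account for M differences of Y, each at most a, and M + 1 differences
  of X, each at least b. The constants (q; q) contribute a ratio 1 - q^(M+1), which is at most
  1.\<close>

lemma link_step_factor_le:
  assumes Y: "interlaces q zp zm (Suc M) Y X" and Y': "interlaces q zp zm M Y' X'"
    and Yp: "abs_prod (Suc M) Y = abs_prod M Y' * \<bar>y\<bar>"
    and YV: "vandermonde (Suc M) Y = vandermonde M Y' * (\<Prod>i<M. f i)"
    and XV: "vandermonde (Suc (Suc M)) X = vandermonde (Suc M) X' * (\<Prod>i<Suc M. g i)"
    and f: "\<And>i. i < M \<Longrightarrow> \<bar>f i\<bar> \<le> a" and g: "\<And>i. i < Suc M \<Longrightarrow> b \<le> \<bar>g i\<bar>" and b: "b > 0"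
  shows "link_step q zp zm (Suc M) X Y
    \<le> link_step q zp zm M X' Y' * \<bar>y\<bar> * (a ^ M / b ^ Suc M)"
proof -
  have r: "\<bar>\<Prod>i<M. f i\<bar> / \<bar>\<Prod>i<Suc M. g i\<bar> \<le> a ^ M / b ^ Suc M"
  proof (rule frac_le)
    show "\<bar>\<Prod>i<M. f i\<bar> \<le> a ^ M" by (rule prod_le_power_abs[OF f])
    show "b ^ Suc M \<le> \<bar>\<Prod>i<Suc M. g i\<bar>" by (rule power_le_prod_abs) (use b g in auto)
    then show "0 \<le> a ^ M" using prod_le_power_abs[OF f] by (meson abs_ge_zero order_trans)
  qed (use b in simp)
  have "qpoch q q (Suc M) = qpoch q q M * (1 - q * q ^ M)"
    by (simp add: qpoch_def)
  also have "\<dots> \<le> qpoch q q M * 1"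
    using q_pos less_imp_le[OF qpoch_q_pos[of M]] by (intro mult_left_mono) auto
  finally have qp: "qpoch q q (Suc M) \<le> qpoch q q M" by simp
  have "link_step q zp zm (Suc M) X Y = qpoch q q (Suc M) *
      ((abs_prod M Y' * (\<bar>vandermonde M Y'\<bar> / \<bar>vandermonde (Suc M) X'\<bar>)) * \<bar>y\<bar>
        * (\<bar>\<Prod>i<M. f i\<bar> / \<bar>\<Prod>i<Suc M. g i\<bar>))"
    using Y by (simp add: link_step_def Yp YV XV abs_mult del: prod.lessThan_Suc)
  also have "\<dots> \<le> qpoch q q M *
      ((abs_prod M Y' * (\<bar>vandermonde M Y'\<bar> / \<bar>vandermonde (Suc M) X'\<bar>)) * \<bar>y\<bar>
        * (a ^ M / b ^ Suc M))"
    using qpoch_q_pos[of M]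
    by (intro mult_mono qp r order_refl mult_nonneg_nonneg divide_nonneg_nonneg)
      (auto simp: abs_prod_def less_imp_le intro!: prod_nonneg)
  also have "\<dots> = link_step q zp zm M X' Y' * \<bar>y\<bar> * (a ^ M / b ^ Suc M)"
    using Y' by (simp add: link_step_def)
  finally show ?thesis .
qed

text \<open>Interlacing with Y in the box forces X i <= Y i <= R for i <= M. So the top point of X
  is at distance at least T - R from all others, even if some of these escape to minus
  infinity.\<close>

lemma prob_Gbox_le_right:
  assumes X: "X \<in> G (Suc (Suc M))" and R: "R < T" "T \<le> X (Suc M)" "0 < R"
    and A: "\<And>F. finite F \<Longrightarrow> F \<subseteq> L \<inter> {-R..R} \<Longrightarrow> (\<Sum>y\<in>F. \<bar>y\<bar>) \<le> A"
  shows "measure_pmf.prob (link_pmf (Suc M) X) (Gbox (Suc M) R)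
    \<le> A * ((2 * R) ^ M / (T - R) ^ Suc M)"
proof (rule prob_Gbox_le[OF X _ _ A refl])
  let ?S = "{Y. interlaces q zp zm (Suc M) Y X \<and> (\<forall>i<Suc M. \<bar>Y i\<bar> \<le> R)}"
  show X': "X(Suc M := 0) \<in> G (Suc M)"
    using X unfolding conf_def by auto
  show "0 \<le> (2 * R) ^ M / (T - R) ^ Suc M" using R by simp
  show "inj_on (\<lambda>Y. (Y(M := 0), Y M)) ?S"
  proof (rule inj_onI)
    fix Y Z :: "nat \<Rightarrow> real"
    assume eq: "(Y(M := 0), Y M) = (Z(M := 0), Z M)"
    show "Y = Z"
    proof
      fix i
      have "(Y(M := 0)) i = (Z(M := 0)) i" "Y M = Z M" using eq by simp_all
      then show "Y i = Z i" by (cases "i = M") simp_all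
    qed
  qed
  fix Y assume Y: "Y \<in> ?S"
  then show "Y M \<in> L \<inter> {-R..R}"
    unfolding interlaces_def by (auto simp: abs_le_iff minus_le_iff dest: confD(1))
  have Y': "interlaces q zp zm M (Y(M := 0)) (X(Suc M := 0))"
    using Y X' unfolding interlaces_def conf_def by auto
  have Xi: "X i \<le> Y i" "Y i \<le> R" "\<bar>Y i\<bar> \<le> R" if "i \<le> M" for i
    using Y that lattice_interval_bounds[of "Y i" "X i" "X (Suc i)"]
    unfolding interlaces_def by (auto simp: abs_le_iff)
  show "link_step q zp zm (Suc M) X Y \<le> link_step q zp zm M (X(Suc M := 0)) (Y(M := 0))
      * \<bar>Y M\<bar> * ((2 * R) ^ M / (T - R) ^ Suc M)"
  proof (rule link_step_factor_le[OF _ Y' _ vandermonde_split_last vandermonde_split_last])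
    show "abs_prod (Suc M) Y = abs_prod M (Y(M := 0)) * \<bar>Y M\<bar>"
      by (simp add: abs_prod_def)
    show "\<bar>Y i - Y M\<bar> \<le> 2 * R" if "i < M" for i
      using Xi(3)[of i] Xi(3)[of M] that by linarith
    show "T - R \<le> \<bar>X i - X (Suc M)\<bar>" if "i < Suc M" for i
      using Xi(1,2)[of i] R that by linarith
  qed (use Y R in auto)
qed

text \<open>Mirror image of \<open>prob_Gbox_le_right\<close>; dropping the lowest points shifts all
  indices by one.\<close>

lemma prob_Gbox_le_left:
  assumes X: "X \<in> G (Suc (Suc M))" and R: "R < T" "X 0 \<le> - T" "0 < R"
    and A: "\<And>F. finite F \<Longrightarrow> F \<subseteq> L \<inter> {-R..R} \<Longrightarrow> (\<Sum>y\<in>F. \<bar>y\<bar>) \<le> A"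
  shows "measure_pmf.prob (link_pmf (Suc M) X) (Gbox (Suc M) R)
    \<le> A * ((2 * R) ^ M / (T - R) ^ Suc M)"
proof (rule prob_Gbox_le[OF X _ _ A refl])
  let ?S = "{Y. interlaces q zp zm (Suc M) Y X \<and> (\<forall>i<Suc M. \<bar>Y i\<bar> \<le> R)}"
  let ?X = "\<lambda>i. X (Suc i)"
  show X': "?X \<in> G (Suc M)"
    using X unfolding conf_def by auto
  show "0 \<le> (2 * R) ^ M / (T - R) ^ Suc M" using R by simp
  show "inj_on (\<lambda>Y. (\<lambda>i. Y (Suc i), Y 0)) ?S"
  proof (rule inj_onI)
    fix Y Z :: "nat \<Rightarrow> real"
    assume "(\<lambda>i. Y (Suc i), Y 0) = (\<lambda>i. Z (Suc i), Z 0)"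
    then have "Y i = Z i" for i by (cases i) (auto simp: fun_eq_iff)
    then show "Y = Z" by blast
  qed
  fix Y assume Y: "Y \<in> ?S"
  then show "Y 0 \<in> L \<inter> {-R..R}"
    unfolding interlaces_def by (auto simp: abs_le_iff minus_le_iff dest: confD(1))
  have Y': "interlaces q zp zm M (\<lambda>i. Y (Suc i)) ?X"
    using Y X' unfolding interlaces_def conf_def by auto
  have Xi: "Y i \<le> X (Suc i)" "- R \<le> Y i" "\<bar>Y i\<bar> \<le> R" if "i \<le> M" for i
    using Y that lattice_interval_bounds[of "Y i" "X i" "X (Suc i)"] unfolding interlaces_def
    by (auto simp: abs_le_iff minus_le_iff)
  show "link_step q zp zm (Suc M) X Y \<le> link_step q zp zm M ?X (\<lambda>i. Y (Suc i))
      * \<bar>Y 0\<bar> * ((2 * R) ^ M / (T - R) ^ Suc M)"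
  proof (rule link_step_factor_le[OF _ Y' _ vandermonde_split_first vandermonde_split_first])
    show "abs_prod (Suc M) Y = abs_prod M (\<lambda>i. Y (Suc i)) * \<bar>Y 0\<bar>"
      by (simp add: abs_prod_def prod.lessThan_Suc_shift del: prod.lessThan_Suc)
    show "\<bar>Y 0 - Y (Suc i)\<bar> \<le> 2 * R" if "i < M" for i
      using Xi(3)[of "Suc i"] Xi(3)[of 0] that by linarith
    show "T - R \<le> \<bar>X 0 - X (Suc i)\<bar>" if "i < Suc M" for i
      using Xi(1,2)[of i] R that by linarith
  qed (use Y R in auto)
qed

lemma expectation_link_pmf_small:
  assumes X: "X \<in> G (Suc N)" and B: "\<And>Y. Y \<in> Gbar N \<Longrightarrow> \<bar>f Y\<bar> \<le> B"
    and e: "\<And>Y. Y \<in> Gbar N - Gbox N R \<Longrightarrow> \<bar>f Y\<bar> \<le> e" "0 \<le> e"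
  shows "\<bar>measure_pmf.expectation (link_pmf N X) f\<bar>
    \<le> B * measure_pmf.prob (link_pmf N X) (Gbox N R) + e"
proof -
  let ?p = "link_pmf N X"
  have supp: "set_pmf ?p \<subseteq> Gbar N"
    using set_link_pmf[OF X] G_subset_Gbar unfolding interlaces_def by blast
  have B0: "0 \<le> B" if "Y \<in> Gbar N" for Y using B[OF that] by linarith
  have ind: "integrable ?p (indicator (Gbox N R) :: _ \<Rightarrow> real)"
    by (rule integrable_pmf_bounded_on[of UNIV _ 1]) (auto simp: indicator_def)
  have "\<bar>measure_pmf.expectation ?p f\<bar> \<le> measure_pmf.expectation ?p (\<lambda>Y. \<bar>f Y\<bar>)"
    by (rule integral_abs_bound)
  also have "\<dots> \<le> measure_pmf.expectation ?p (\<lambda>Y. B * indicator (Gbox N R) Y + e)"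
  proof (rule integral_mono_AE)
    show "integrable ?p (\<lambda>Y. \<bar>f Y\<bar>)"
      by (rule integrable_pmf_bounded_on[OF _ supp, of _ B]) (use B in auto)
    show "AE Y in ?p. \<bar>f Y\<bar> \<le> B * indicator (Gbox N R) Y + e"
      unfolding AE_measure_pmf_iff
    proof
      fix Y assume "Y \<in> set_pmf ?p"
      then have "Y \<in> Gbar N" using supp by blast
      then show "\<bar>f Y\<bar> \<le> B * indicator (Gbox N R) Y + e"
        using B[of Y] e by (auto simp: indicator_def)
    qed
  qed (use ind in simp)
  also have "\<dots> = B * measure_pmf.prob ?p (Gbox N R) + e"
    using ind by simp
  finally show ?thesis .
qed

lemma feller_ext_pmf:
  assumes f: "f \<in> C0 (Gbar (Suc M))"
  shows "(\<lambda>X. measure_pmf.expectation (ext_pmf (Suc M) X) f) \<in> C0 (Gbar (Suc (Suc M)))"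
proof -
  let ?E = "\<lambda>X. measure_pmf.expectation (ext_pmf (Suc M) X) f"
  have "continuous_on (Gbar (Suc M)) f" using f by (simp add: C0_def)
  then have cont: "continuous_on (Gbar (Suc (Suc M))) ?E"
    by (rule continuous_on_expectation_ext_pmf)
  obtain B where B: "B > 0" "\<And>Y. Y \<in> Gbar (Suc M) \<Longrightarrow> \<bar>f Y\<bar> \<le> B"
    by (rule C0_bounded[OF f]) (rule that)
  have "\<exists>C. compact C \<and> C \<subseteq> Gbar (Suc (Suc M)) \<and> (\<forall>X\<in>Gbar (Suc (Suc M)) - C. \<bar>?E X\<bar> < e)"
    if e: "e > 0" for e
  proof -
    have "e / 3 > 0" using e by simp
    then obtain C where C: "compact C" "C \<subseteq> Gbar (Suc M)" "\<forall>Y\<in>Gbar (Suc M) - C. \<bar>f Y\<bar> < e / 3"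
      using f unfolding C0_def mem_Collect_eq by meson
    obtain R where R: "R > 0" "C \<subseteq> Gbox (Suc M) R"
      by (rule compact_subset_Gbox[OF C(1,2)]) (rule that)
    obtain A where A: "A \<ge> 0" "\<And>F. finite F \<Longrightarrow> F \<subseteq> L \<inter> {-R..R} \<Longrightarrow> (\<Sum>y\<in>F. \<bar>y\<bar>) \<le> A"
      by (rule finite_lattice_sum_bound[of R]) (rule that)
    define D where "D = B * A * (2 * R) ^ M"
    have D: "D \<ge> 0" using B(1) A(1) R(1) by (simp add: D_def)
    \<comment> \<open>The summand 1 gives T - R >= 1, hence (T - R)^(M+1) >= T - R >= 3 D /
      e.\<close>
    define T where "T = R + 1 + 3 * D / e"
    have T: "R < T" "1 \<le> T - R" using D e by (auto simp: T_def add_pos_nonneg)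
    have DT: "D / (T - R) ^ Suc M \<le> e / 3"
    proof -
      have "T - R \<le> (T - R) ^ Suc M"
        using T(2) self_le_power[of "T - R" "Suc M"] by simp
      moreover have "D \<le> e / 3 * (T - R)"
        using e D by (simp add: T_def field_simps)
      ultimately have "D \<le> e / 3 * (T - R) ^ Suc M"
        using mult_left_mono[of "T - R" "(T - R) ^ Suc M" "e / 3"] e by linarith
      then show ?thesis using T(2) by (simp add: pos_divide_le_eq del: power_Suc)
    qed
    \<comment> \<open>One third comes from the box and one third from its complement; the slack
      keeps the final bound strict after a limit.\<close>
    have small: "\<bar>?E X\<bar> \<le> 2 * e / 3" if X: "X \<in> G (Suc (Suc M))" "i \<le> Suc M" "\<bar>X i\<bar> > T" for X i
    proof -
      have "X 0 \<le> X i" "X i \<le> X (Suc M)"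
        using conf_mono[OF X(1)] X(2) by auto
      \<comment> \<open>A large coordinate in the middle forces an extreme one to be large as
        well.\<close>
      then have "T \<le> X (Suc M) \<or> X 0 \<le> - T" using X(3) by linarith
      then have "measure_pmf.prob (link_pmf (Suc M) X) (Gbox (Suc M) R)
          \<le> A * ((2 * R) ^ M / (T - R) ^ Suc M)"
        using prob_Gbox_le_right[OF X(1) T(1) _ R(1) A(2)] prob_Gbox_le_left[OF X(1) T(1) _ R(1) A(2)]
        by blast
      then have "B * measure_pmf.prob (link_pmf (Suc M) X) (Gbox (Suc M) R)
          \<le> B * (A * ((2 * R) ^ M / (T - R) ^ Suc M))"
        using B(1) by (intro mult_left_mono) auto
      also have "\<dots> = D / (T - R) ^ Suc M" by (simp add: D_def)
      also have "\<dots> \<le> e / 3" by (rule DT)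
      finally have "B * measure_pmf.prob (link_pmf (Suc M) X) (Gbox (Suc M) R) \<le> e / 3" .
      moreover have "\<bar>measure_pmf.expectation (link_pmf (Suc M) X) f\<bar>
          \<le> B * measure_pmf.prob (link_pmf (Suc M) X) (Gbox (Suc M) R) + e / 3"
      proof (rule expectation_link_pmf_small[OF X(1) B(2)])
        show "\<bar>f Y\<bar> \<le> e / 3" if "Y \<in> Gbar (Suc M) - Gbox (Suc M) R" for Y
          using C(3) R(2) that by (meson DiffD1 DiffD2 DiffI less_imp_le subsetD)
      qed (use e in auto)
      ultimately show ?thesis using X(1) by (simp add: ext_pmf_def)
    qed
    show ?thesis
    proof (intro exI conjI ballI)
      show "compact (Gbox (Suc (Suc M)) T)" by (rule compact_Gbox)
      show "Gbox (Suc (Suc M)) T \<subseteq> Gbar (Suc (Suc M))" by (rule Gbox_subset)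
      fix X assume X: "X \<in> Gbar (Suc (Suc M)) - Gbox (Suc (Suc M)) T"
      then obtain i where i: "i \<le> Suc M" "\<bar>X i\<bar> > T"
        unfolding Gbox_def by (auto simp: not_le less_Suc_eq_le)
      let ?U = "{X :: nat \<Rightarrow> real. T < \<bar>X i\<bar>}"
      \<comment> \<open>Openness allows approximation of X by lattice configurations whose
        coordinate i still exceeds T in absolute value.\<close>
      have "open ?U"
        by (intro open_Collect_less continuous_intros continuous_on_coordinate)
      then have "X \<in> closure (?U \<inter> G (Suc (Suc M)))"
        using open_Int_closure_subset[of ?U "G (Suc (Suc M))"] X i unfolding Gbar_eq_closure by auto
      then obtain x where x: "\<And>n. x n \<in> ?U \<inter> G (Suc (Suc M))" "x \<longlonglongrightarrow> X"
        unfolding closure_sequential by blast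
      have "(\<lambda>n. ?E (x n)) \<longlonglongrightarrow> ?E X"
        by (rule continuous_on_tendsto_compose[OF cont x(2)])
          (use X x(1) G_subset_Gbar in \<open>auto intro!: always_eventually\<close>)
      then have "(\<lambda>n. \<bar>?E (x n)\<bar>) \<longlonglongrightarrow> \<bar>?E X\<bar>" by (rule tendsto_rabs)
      then have "\<bar>?E X\<bar> \<le> 2 * e / 3"
        by (rule LIMSEQ_le_const2) (use small[OF _ i(1)] x(1) in auto)
      then show "\<bar>?E X\<bar> < e" using e by simp
    qed
  qed
  then show ?thesis using cont unfolding C0_def by blast
qed

end

section \<open>Composition of the steps\<close>

lemma expectation_bind_pmf_bounded:
  fixes f :: "'b \<Rightarrow> real"
  assumes "\<And>x y. x \<in> set_pmf p \<Longrightarrow> y \<in> set_pmf (k x) \<Longrightarrow> \<bar>f y\<bar> \<le> B"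
  shows "measure_pmf.expectation (bind_pmf p k) f
    = measure_pmf.expectation p (\<lambda>x. measure_pmf.expectation (k x) f)"
proof -
  \<comment> \<open>\<open>integral_bind\<close> asks for a global bound, whereas f is controlled on
    the support only.\<close>
  define g where "g y = (if y \<in> set_pmf (bind_pmf p k) then f y else 0)" for y
  have "measure_pmf.expectation (bind_pmf p k) f = measure_pmf.expectation (bind_pmf p k) g"
    by (rule integral_cong_AE) (auto simp: AE_measure_pmf_iff g_def)
  also have "\<dots> = measure_pmf.expectation p (\<lambda>x. measure_pmf.expectation (k x) g)"
    unfolding measure_pmf_bind
  proof (rule integral_bind[where K = "count_space UNIV" and B = "\<bar>B\<bar>" and B' = 1])
    show "\<bar>g y\<bar> \<le> \<bar>B\<bar>" for y using assms by (fastforce simp: g_def)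
    show "AE x in measure_pmf p. emeasure (measure_pmf (k x)) (space (measure_pmf (k x))) \<le> ennreal 1"
      using measure_pmf.emeasure_space_1 by simp
    show "(\<lambda>x. measure_pmf (k x)) \<in> measurable (measure_pmf p) (subprob_algebra (count_space UNIV))"
      using measurable_measure_pmf[of k] by simp
  qed (auto intro: measure_pmf.finite_measure)
  also have "\<dots> = measure_pmf.expectation p (\<lambda>x. measure_pmf.expectation (k x) f)"
  proof (rule integral_cong_AE)
    show "AE x in p. measure_pmf.expectation (k x) g = measure_pmf.expectation (k x) f"
      unfolding AE_measure_pmf_iff
      by (intro ballI integral_cong_AE) (auto simp: AE_measure_pmf_iff g_def)
  qed auto
  finally show ?thesis .
qed

lemma C0_cong:
  assumes "f \<in> C0 S" "\<And>x. x \<in> S \<Longrightarrow> f x = g x"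
  shows "g \<in> C0 S"
proof -
  have "continuous_on S g"
    using assms continuous_on_cong[of S S f g] by (auto simp: C0_def)
  moreover have "(\<forall>x\<in>S - C. \<bar>f x\<bar> < e) \<longleftrightarrow> (\<forall>x\<in>S - C. \<bar>g x\<bar> < e)" for C e
    using assms(2) by auto
  ultimately show ?thesis using assms(1) by (simp add: C0_def)
qed

context q_lattice
begin

text \<open>Composed in the order of \<open>link_iter\<close>, top step outermost, so that entries,
  continuity and the Feller property all follow by induction on d.\<close>

primrec iter_pmf :: "nat \<Rightarrow> nat \<Rightarrow> (nat \<Rightarrow> real) \<Rightarrow> (nat \<Rightarrow> real) pmf" where
  "iter_pmf K 0 X = return_pmf X"
| "iter_pmf K (Suc d) X = bind_pmf (ext_pmf (K + d) X) (iter_pmf K d)"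

lemma set_ext_pmf: "X \<in> Gbar (Suc N) \<Longrightarrow> set_pmf (ext_pmf N X) \<subseteq> Gbar N"
  using ext_pmf(1) Gbox_subset by blast

lemma set_iter_pmf: "X \<in> Gbar (K + d) \<Longrightarrow> set_pmf (iter_pmf K d X) \<subseteq> Gbar K"
proof (induction d arbitrary: X)
  case (Suc d)
  then show ?case using set_ext_pmf[of X "K + d"] by fastforce
qed simp

text \<open>From a lattice configuration the top step leads only to lattice configurations, where
  \<open>ext_pmf\<close> is the explicit kernel.\<close>

lemma pmf_iter_pmf:
  "X \<in> G (K + d) \<Longrightarrow> pmf (iter_pmf K d X) Y = link_iter q zp zm K d X Y"
proof (induction d arbitrary: X)
  case 0
  then show ?case by (simp add: indicator_def)
next
  case (Suc d)
  then have X: "X \<in> G (Suc (K + d))" by simp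
  let ?p = "ext_pmf (K + d) X"
  have p: "?p = link_pmf (K + d) X" using X by (simp add: ext_pmf_def)
  have supp: "set_pmf ?p \<subseteq> G (K + d)"
    unfolding p using set_link_pmf[OF X] by (auto simp: interlaces_def)
  have "((\<lambda>Z. pmf ?p Z * pmf (iter_pmf K d Z) Y)
      has_sum measure_pmf.expectation ?p (\<lambda>Z. pmf (iter_pmf K d Z) Y)) (G (K + d))"
    by (rule has_sum_expectation[OF _ supp, of _ 1]) (simp add: pmf_le_1)
  then have "pmf (iter_pmf K (Suc d) X) Y
      = (\<Sum>\<^sub>\<infinity>Z\<in>G (K + d). pmf ?p Z * pmf (iter_pmf K d Z) Y)"
    by (simp add: pmf_bind infsumI)
  also have "\<dots> = link_iter q zp zm K (Suc d) X Y"
    using Suc.IH by (auto intro!: infsum_cong simp: p pmf_link_pmf[OF X])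
  finally show ?case .
qed

lemma expectation_iter_pmf_Suc:
  fixes f :: "(nat \<Rightarrow> real) \<Rightarrow> real"
  assumes "X \<in> Gbar (Suc (K + d))" "\<And>Y. Y \<in> Gbar K \<Longrightarrow> \<bar>f Y\<bar> \<le> B"
  shows "measure_pmf.expectation (iter_pmf K (Suc d) X) f
    = measure_pmf.expectation (ext_pmf (K + d) X) (\<lambda>Z. measure_pmf.expectation (iter_pmf K d Z) f)"
  unfolding iter_pmf.simps
proof (rule expectation_bind_pmf_bounded)
  fix Z Y assume "Z \<in> set_pmf (ext_pmf (K + d) X)" "Y \<in> set_pmf (iter_pmf K d Z)"
  then show "\<bar>f Y\<bar> \<le> B"
    using set_ext_pmf[OF assms(1)] set_iter_pmf[of Z K d] by (intro assms(2)) blast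
qed

lemma continuous_on_expectation_iter_pmf:
  fixes f :: "(nat \<Rightarrow> real) \<Rightarrow> real"
  assumes "continuous_on (Gbar K) f" "\<And>Y. Y \<in> Gbar K \<Longrightarrow> \<bar>f Y\<bar> \<le> B"
  shows "continuous_on (Gbar (K + d)) (\<lambda>X. measure_pmf.expectation (iter_pmf K d X) f)"
proof (induction d)
  case (Suc d)
  show ?case
    using continuous_on_expectation_ext_pmf[OF Suc]
    by (rule continuous_on_cong[THEN iffD1, rotated 2])
      (auto simp: expectation_iter_pmf_Suc[OF _ assms(2)] simp del: iter_pmf.simps)
qed (use assms in simp)

lemma feller_iter_pmf:
  assumes f: "f \<in> C0 (Gbar K)" and K: "1 \<le> K"
  shows "(\<lambda>X. measure_pmf.expectation (iter_pmf K d X) f) \<in> C0 (Gbar (K + d))"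
proof (induction d)
  case (Suc d)
  obtain B where B: "\<And>Y. Y \<in> Gbar K \<Longrightarrow> \<bar>f Y\<bar> \<le> B"
    by (rule C0_bounded[OF f]) (rule that)
  \<comment> \<open>Here 1 <= K enters. A step to level 0 would send the constant 1 to itself, which
    does not vanish at infinity.\<close>
  obtain M where M: "K + d = Suc M" using K by (cases "K + d") auto
  have "(\<lambda>X. measure_pmf.expectation (ext_pmf (K + d) X)
      (\<lambda>Z. measure_pmf.expectation (iter_pmf K d Z) f)) \<in> C0 (Gbar (Suc (K + d)))"
    using feller_ext_pmf[of "\<lambda>Z. measure_pmf.expectation (iter_pmf K d Z) f" M] Suc
    unfolding M by simp
  then show ?case
    unfolding add_Suc_right
    by (rule C0_cong) (simp add: expectation_iter_pmf_Suc[OF _ B] del: iter_pmf.simps)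
qed (use f in simp)

section \<open>Existence and uniqueness of the extended kernel\<close>

lemma is_link_extension_iter_pmf:
  assumes "K < N"
  shows "is_link_extension q zp zm N K (iter_pmf K (N - K))"
proof -
  have N: "K + (N - K) = N" using assms by simp
  show ?thesis
    unfolding is_link_extension_def link_def
  proof (intro conjI ballI allI impI)
    show "set_pmf (iter_pmf K (N - K) X) \<subseteq> Gbar K" if "X \<in> Gbar N" for X
      using set_iter_pmf[of X K "N - K"] that by (simp add: N)
    show "pmf (iter_pmf K (N - K) X) Y = link_iter q zp zm K (N - K) X Y" if "X \<in> G N" for X Y
      using pmf_iter_pmf[of X K "N - K"] that by (simp add: N)
    fix f :: "(nat \<Rightarrow> real) \<Rightarrow> real"
    assume f: "continuous_on (Gbar K) f \<and> bounded (f ` Gbar K)"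
    then obtain B where "\<And>Y. Y \<in> Gbar K \<Longrightarrow> \<bar>f Y\<bar> \<le> B"
      by (auto simp: bounded_iff)
    with f show "continuous_on (Gbar N) (\<lambda>X. measure_pmf.expectation (iter_pmf K (N - K) X) f)"
      using continuous_on_expectation_iter_pmf[of K f B "N - K"] by (simp add: N)
  qed
qed

text \<open>Both extensions coincide on the dense set of lattice configurations, and averages of f
  are continuous. Agreement of averages is what allows the chosen extension to be replaced by the
  composed one.\<close>

lemma is_link_extension_unique:
  fixes f :: "(nat \<Rightarrow> real) \<Rightarrow> real"
  assumes E: "is_link_extension q zp zm N K E" "is_link_extension q zp zm N K E'"
    and f: "continuous_on (Gbar K) f" "bounded (f ` Gbar K)" and X: "X \<in> Gbar N"
  shows "measure_pmf.expectation (E X) f = measure_pmf.expectation (E' X) f"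
proof -
  let ?D = "\<lambda>X. measure_pmf.expectation (E X) f - measure_pmf.expectation (E' X) f"
  have "?D X = 0"
  proof (rule continuous_constant_on_closure[where f = ?D and S = "G N"])
    show "continuous_on (closure (G N)) ?D"
      using E f unfolding is_link_extension_def Gbar_eq_closure[symmetric]
      by (intro continuous_on_diff) blast+
    have "E Z = E' Z" if "Z \<in> G N" for Z
      using E that unfolding is_link_extension_def by (intro pmf_eqI) simp
    then show "?D Z = 0" if "Z \<in> G N" for Z using that by simp
    show "X \<in> closure (G N)" using X by (simp add: Gbar_eq_closure)
  qed
  then show ?thesis by simp
qed

end

theorem theorem9p1:
  fixes q zp zm :: real and N K :: nat
  assumes "0 < q" "q < 1" and "zp > 0" and "zm < 0"
    and "1 \<le> K" and "K < N"
  shows "\<forall>f\<in>C0 (conf_closure q zp zm K). ext_link_op q zp zm N K f \<in> C0 (conf_closure q zp zm N)"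
proof
  interpret q_lattice q zp zm by unfold_locales fact+
  fix f assume f: "f \<in> C0 (Gbar K)"
  obtain B where B: "\<And>Y. Y \<in> Gbar K \<Longrightarrow> \<bar>f Y\<bar> \<le> B"
    by (rule C0_bounded[OF f]) (rule that)
  have cont: "continuous_on (Gbar K) f" using f by (simp add: C0_def)
  have bdd: "bounded (f ` Gbar K)" using B by (auto simp: bounded_iff)
  note ext = is_link_extension_iter_pmf[OF assms(6)]
  \<comment> \<open>The composed kernel witnesses that the choice in \<open>ext_link\<close> is made
    among actual extensions.\<close>
  have ext_link: "is_link_extension q zp zm N K (ext_link q zp zm N K)"
    unfolding ext_link_def
    by (rule someI[of "is_link_extension q zp zm N K", OF ext])
  have eq: "measure_pmf.expectation (iter_pmf K (N - K) X) f = ext_link_op q zp zm N K f X"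
    if X: "X \<in> Gbar N" for X
  proof -
    have "set_pmf (ext_link q zp zm N K X) \<subseteq> Gbar K"
      using ext_link X unfolding is_link_extension_def by blast
    from has_sum_expectation[OF B this]
    have "ext_link_op q zp zm N K f X = measure_pmf.expectation (ext_link q zp zm N K X) f"
      unfolding ext_link_op_def by (simp add: infsumI)
    then show ?thesis
      using is_link_extension_unique[OF ext ext_link cont bdd X] by simp
  qed
  have "(\<lambda>X. measure_pmf.expectation (iter_pmf K (N - K) X) f) \<in> C0 (Gbar N)"
    using feller_iter_pmf[OF f assms(5), of "N - K"] assms(6) by simp
  then show "ext_link_op q zp zm N K f \<in> C0 (Gbar N)"
    by (rule C0_cong) (rule eq)
qed

end
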